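(* For all $h_1,h_2,c_1\in\mathbb{C}$, the Verma module $M(h_1,h_2,c_1)$ of $\mathcal{S}$ is reducible.
   Context: Everything is over $\mathbb{C}$; $\mathbb{N}=\{0,1,2,\dots\}$. The super extended Ovsienko--Roger algebra $\mathcal{S}$ is the Lie superalgebra with basis $\{L_m,W_m,G_r,C_1,C_2 : m\in\mathbb{Z},\ r\in\mathbb{Z}+\frac12\}$, where $L_m,W_m,C_1,C_2$ are even and $G_r$ is odd, with super-brackets (for $m,n\in\mathbb{Z}$, $r,s\in\mathbb{Z}+\frac12$) $$[L_m,L_n]=(n-m)L_{m+n}+\tfrac{m^3-m}{12}\delta_{m+n,0}C_1,\quad [L_m,W_n]=(m+n)W_{m+n}+\delta_{m+n,0}C_2,$$ $$[L_m,G_r]=rG_{m+r},\quad [G_r,G_s]=(r+s)W_{r+s}+\delta_{r+s,0}C_2,\quad [W_m,W_n]=[W_m,G_r]=[\mathcal{S},C_1]=[\mathcal{S},C_2]=0.$$ Put $\mathcal{S}_+=\bigoplus_{m\ge1}(\mathbb{C}L_m\oplus\mathbb{C}W_m)\oplus\bigoplus_{r\in\mathbb{N}+\frac12}\mathbb{C}G_r$ and $\mathcal{S}_0=\mathbb{C}L_0\oplus\mathbb{C}W_0\oplus\mathbb{C}C_1\oplus\mathbb{C}C_2$. For $h_1,h_2,c_1\in\mathbb{C}$ let $\mathbb{C}v$ be the one-dimensional $(\mathcal{S}_0\oplus\mathcal{S}_+)$-module (with $v$ a homogeneous vector) given by $L_0v=h_1v$, $W_0v=h_2v$, $C_1v=c_1v$,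 $C_2v=0$, $\mathcal{S}_+v=0$. The Verma module is $M(h_1,h_2,c_1)=\mathcal{U}(\mathcal{S})\otimes_{\mathcal{U}(\mathcal{S}_0\oplus\mathcal{S}_+)}\mathbb{C}v$, where $\mathcal{U}(\cdot)$ is the universal enveloping (super)algebra. All modules are $\mathbb{Z}_2$-graded; reducible means having a nonzero proper ($\mathbb{Z}_2$-graded) submodule. *)

theory Defs
  imports Complex_Main "HOL-Algebra.QuotRing" "HOL-Algebra.Generated_Groups"
    "HOL-Algebra.Free_Abelian_Groups"
begin

section \<open>The super extended Ovsienko--Roger algebra\<close>

text \<open>\<open>Gg k\<close> stands for the odd basis vector with half-integral index \<open>r = k + 1/2\<close>.\<close>

datatype or_basis = Lg int | Wg int | Gg int | C1g | C2g

text \<open>Parities are Booleans, \<open>True\<close> being odd; their sum in \<open>Z/2\<close> is \<open>\<noteq>\<close>.\<close>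

fun odd_gen :: "or_basis \<Rightarrow> bool" where
  "odd_gen (Gg k) = True"
| "odd_gen _ = False"

type_synonym or_alg = "or_basis \<Rightarrow>\<^sub>0 complex"

definition or_scale :: "complex \<Rightarrow> or_alg \<Rightarrow> or_alg" where
  "or_scale c x = Poly_Mapping.map ((*) c) x"

abbreviation bvec :: "or_basis \<Rightarrow> complex \<Rightarrow> or_alg" where
  "bvec \<equiv> Poly_Mapping.single"

text \<open>With \<open>r = k + 1/2\<close> and \<open>s = l + 1/2\<close> one has \<open>r + s = k + l + 1\<close>. The brackets not listed
  in the presentation are given by super-antisymmetry or vanish.\<close>

fun or_struct :: "or_basis \<Rightarrow> or_basis \<Rightarrow> or_alg" where
  "or_struct (Lg m) (Lg n) = bvec (Lg (m + n)) (of_int (n - m))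
     + (if m + n = 0 then bvec C1g ((of_int m ^ 3 - of_int m) / 12) else 0)"
| "or_struct (Lg m) (Wg n) = bvec (Wg (m + n)) (of_int (m + n))
     + (if m + n = 0 then bvec C2g 1 else 0)"
| "or_struct (Wg n) (Lg m) = - (bvec (Wg (m + n)) (of_int (m + n))
     + (if m + n = 0 then bvec C2g 1 else 0))"
| "or_struct (Lg m) (Gg k) = bvec (Gg (m + k)) (of_int k + 1 / 2)"
| "or_struct (Gg k) (Lg m) = - bvec (Gg (m + k)) (of_int k + 1 / 2)"
| "or_struct (Gg k) (Gg l) = bvec (Wg (k + l + 1)) (of_int (k + l + 1))
     + (if k + l + 1 = 0 then bvec C2g 1 else 0)"
| "or_struct _ _ = 0"

definition or_bracket :: "or_alg \<Rightarrow> or_alg \<Rightarrow> or_alg" where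
  "or_bracket x y = (\<Sum>a\<in>Poly_Mapping.keys x. \<Sum>b\<in>Poly_Mapping.keys y.
     or_scale (Poly_Mapping.lookup x a * Poly_Mapping.lookup y b) (or_struct a b))"

text \<open>The parity-\<open>i\<close> part of the span of a set \<open>B\<close> of basis vectors.\<close>

definition homog :: "or_basis set \<Rightarrow> bool \<Rightarrow> or_alg set" where
  "homog B i = {x. \<forall>a\<in>Poly_Mapping.keys x. a \<in> B \<and> odd_gen a = i}"

text \<open>Basis of the subalgebra \<open>S\<^sub>0 \<oplus> S\<^sub>+\<close>; \<open>r \<ge> 1/2\<close> means \<open>k \<ge> 0\<close>.\<close>

definition borel_basis :: "or_basis set" where
  "borel_basis = {Lg 0, Wg 0, C1g, C2g} \<union> (Lg ` {1..} \<union> Wg ` {1..} \<union> Gg ` {0..})"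


section \<open>Universal enveloping superalgebras\<close>

text \<open>Words under concatenation; finitely supported functions on words form the free associative
  algebra, that is, the tensor algebra on a space with the given basis.\<close>

datatype 'g free_word = Wd (letters: "'g list")

instantiation free_word :: (type) monoid_add
begin
definition "0 = Wd []"
definition "u + v = Wd (letters u @ letters v)"
instance by standard (auto simp: zero_free_word_def plus_free_word_def)
end

type_synonym or_tensor = "or_basis free_word \<Rightarrow>\<^sub>0 complex"

definition tensor_algebra :: "or_basis set \<Rightarrow> or_tensor ring" where
  "tensor_algebra B =
     \<lparr>carrier = {p. \<forall>w\<in>Poly_Mapping.keys p. set (letters w) \<subseteq> B},
      mult = (*), one = 1, ring.zero = 0, add = (+)\<rparr>"

lemma tensor_algebra_ring: "ring (tensor_algebra B)"
proof (rule ringI)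
  show "abelian_group (tensor_algebra B)"
  proof (rule abelian_groupI; (simp add: tensor_algebra_def add.assoc add.commute; fail)?)
    fix x y assume "x \<in> carrier (tensor_algebra B)" "y \<in> carrier (tensor_algebra B)"
    then show "x \<oplus>\<^bsub>tensor_algebra B\<^esub> y \<in> carrier (tensor_algebra B)"
      using Poly_Mapping.keys_add[of x y] by (auto simp: tensor_algebra_def)
  next
    fix x assume "x \<in> carrier (tensor_algebra B)"
    then show "\<exists>y\<in>carrier (tensor_algebra B). y \<oplus>\<^bsub>tensor_algebra B\<^esub> x = \<zero>\<^bsub>tensor_algebra B\<^esub>"
      by (intro bexI[of _ "- x"]) (auto simp: tensor_algebra_def)
  qed
  show "Group.monoid (tensor_algebra B)"
  proof (rule monoidI; (simp add: tensor_algebra_def mult.assoc; fail)?)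
    fix x y assume "x \<in> carrier (tensor_algebra B)" "y \<in> carrier (tensor_algebra B)"
    then show "x \<otimes>\<^bsub>tensor_algebra B\<^esub> y \<in> carrier (tensor_algebra B)"
      using Poly_Mapping.keys_mult[of x y]
      by (fastforce simp: tensor_algebra_def plus_free_word_def)
  next
    show "\<one>\<^bsub>tensor_algebra B\<^esub> \<in> carrier (tensor_algebra B)"
      by (simp add: tensor_algebra_def zero_free_word_def)
  qed
qed (simp_all add: tensor_algebra_def distrib_left distrib_right)

definition emb :: "or_alg \<Rightarrow> or_tensor" where
  "emb x = (\<Sum>a\<in>Poly_Mapping.keys x. Poly_Mapping.single (Wd [a]) (Poly_Mapping.lookup x a))"

text \<open>\<open>U(b)\<close> for the subalgebra \<open>b\<close> with basis \<open>B\<close> is \<open>T(b)\<close> modulo the two-sided ideal generated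
  by \<open>xy - (-1)\<^sup>|\<^sup>x\<^sup>|\<^sup>|\<^sup>y\<^sup>| yx - [x,y]\<close> for homogeneous \<open>x, y\<close> in \<open>b\<close>.\<close>

definition env_relations :: "or_basis set \<Rightarrow> or_tensor set" where
  "env_relations B =
     {emb x * emb y - (if i \<and> j then - 1 else 1) * (emb y * emb x) - emb (or_bracket x y)
       | x y i j. x \<in> homog B i \<and> y \<in> homog B j}"

definition env_ideal :: "or_basis set \<Rightarrow> or_tensor set" where
  "env_ideal B = Idl\<^bsub>tensor_algebra B\<^esub> (env_relations B)"

definition enveloping :: "or_basis set \<Rightarrow> or_tensor set ring" where
  "enveloping B = tensor_algebra B Quot env_ideal B"

abbreviation U_S :: "or_tensor set ring" where "U_S \<equiv> enveloping UNIV"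
abbreviation U_b :: "or_tensor set ring" where "U_b \<equiv> enveloping borel_basis"

definition env_class :: "or_tensor \<Rightarrow> or_tensor set" where
  "env_class p = env_ideal UNIV +>\<^bsub>tensor_algebra UNIV\<^esub> p"

text \<open>The homomorphism \<open>U(S\<^sub>0 \<oplus> S\<^sub>+) \<rightarrow> U(S)\<close> induced by the inclusion.\<close>

definition env_incl :: "or_tensor set \<Rightarrow> or_tensor set" where
  "env_incl b = (\<Union>p\<in>b. env_class p)"

definition env_part :: "bool \<Rightarrow> or_tensor set set" where
  "env_part i = env_class `
     {p. \<forall>w\<in>Poly_Mapping.keys p. odd (length (filter odd_gen (letters w))) = i}"


section \<open>Tensor products over a noncommutative ring\<close>

text \<open>\<open>M\<close> is a right \<open>R\<close>-module with action \<open>ra\<close>, and the left \<open>R\<close>-module is the whole type \<open>'n\<close>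
  with action \<open>la\<close>.\<close>

definition tensor_free :: "('m, 'x) ring_scheme \<Rightarrow> ('m \<times> 'n \<Rightarrow>\<^sub>0 int) monoid" where
  "tensor_free M = free_Abelian_group (carrier M \<times> UNIV)"

definition tensor_rels :: "('r, 'y) ring_scheme \<Rightarrow> ('m, 'x) ring_scheme \<Rightarrow> ('m \<Rightarrow> 'r \<Rightarrow> 'm) \<Rightarrow>
    ('r \<Rightarrow> 'n \<Rightarrow> 'n) \<Rightarrow> ('m \<times> 'n::ab_group_add \<Rightarrow>\<^sub>0 int) set" where
  "tensor_rels R M ra la = generate (tensor_free M)
     ({frag_of (m \<oplus>\<^bsub>M\<^esub> m', n) - frag_of (m, n) - frag_of (m', n)
         | m m' n. m \<in> carrier M \<and> m' \<in> carrier M}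
    \<union> {frag_of (m, n + n') - frag_of (m, n) - frag_of (m, n') | m n n'. m \<in> carrier M}
    \<union> {frag_of (ra m r, n) - frag_of (m, la r n) | m r n. m \<in> carrier M \<and> r \<in> carrier R})"

definition tensor_product :: "('r, 'y) ring_scheme \<Rightarrow> ('m, 'x) ring_scheme \<Rightarrow> ('m \<Rightarrow> 'r \<Rightarrow> 'm) \<Rightarrow>
    ('r \<Rightarrow> 'n \<Rightarrow> 'n) \<Rightarrow> ('m \<times> 'n::ab_group_add \<Rightarrow>\<^sub>0 int) set monoid" where
  "tensor_product R M ra la = tensor_free M Mod tensor_rels R M ra la"


section \<open>Verma modules\<close>

text \<open>The action of the basis vectors of \<open>S\<^sub>0 \<oplus> S\<^sub>+\<close> on \<open>Cv\<close>, where \<open>z\<close> stands for \<open>z v\<close>.\<close>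

definition hw_act :: "complex \<Rightarrow> complex \<Rightarrow> complex \<Rightarrow> or_basis \<Rightarrow> complex \<Rightarrow> complex" where
  "hw_act h1 h2 c1 a z =
     (if a = Lg 0 then h1 * z else if a = Wg 0 then h2 * z else if a = C1g then c1 * z else 0)"

definition hw_tensor_act :: "complex \<Rightarrow> complex \<Rightarrow> complex \<Rightarrow> or_tensor \<Rightarrow> complex \<Rightarrow> complex" where
  "hw_tensor_act h1 h2 c1 p z =
     (\<Sum>w\<in>Poly_Mapping.keys p. Poly_Mapping.lookup p w * foldr (hw_act h1 h2 c1) (letters w) z)"

definition hw_env_act :: "complex \<Rightarrow> complex \<Rightarrow> complex \<Rightarrow> or_tensor set \<Rightarrow> complex \<Rightarrow> complex" where
  "hw_env_act h1 h2 c1 b z = the_elem ((\<lambda>p. hw_tensor_act h1 h2 c1 p z) ` b)"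

definition right_act :: "or_tensor set \<Rightarrow> or_tensor set \<Rightarrow> or_tensor set" where
  "right_act u b = u \<otimes>\<^bsub>U_S\<^esub> env_incl b"

type_synonym verma_elem = "(or_tensor set \<times> complex \<Rightarrow>\<^sub>0 int) set"

definition verma_rels :: "complex \<Rightarrow> complex \<Rightarrow> complex \<Rightarrow> verma_elem" where
  "verma_rels h1 h2 c1 = tensor_rels U_b U_S right_act (hw_env_act h1 h2 c1)"

definition verma_group :: "complex \<Rightarrow> complex \<Rightarrow> complex \<Rightarrow> verma_elem monoid" where
  "verma_group h1 h2 c1 = tensor_product U_b U_S right_act (hw_env_act h1 h2 c1)"

definition pure_tensor ::
    "complex \<Rightarrow> complex \<Rightarrow> complex \<Rightarrow> or_tensor set \<Rightarrow> complex \<Rightarrow> verma_elem" where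
  "pure_tensor h1 h2 c1 u z = verma_rels h1 h2 c1 #>\<^bsub>tensor_free U_S\<^esub> frag_of (u, z)"

text \<open>Left multiplication by \<open>u\<close> in \<open>U(S)\<close>: the additive extension of \<open>u' \<otimes> z \<mapsto> u u' \<otimes> z\<close>.\<close>

definition verma_env_act ::
    "complex \<Rightarrow> complex \<Rightarrow> complex \<Rightarrow> or_tensor set \<Rightarrow> verma_elem \<Rightarrow> verma_elem" where
  "verma_env_act h1 h2 c1 u X =
     (\<Union>x\<in>X. verma_rels h1 h2 c1 #>\<^bsub>tensor_free U_S\<^esub>
        frag_extend (\<lambda>(u', z). frag_of (u \<otimes>\<^bsub>U_S\<^esub> u', z)) x)"

text \<open>Modules over \<open>S\<close>: the underlying abelian group is written multiplicatively, as in
  \<^const>\<open>free_Abelian_group\<close>, so that \<open>\<one>\<close> is its zero element.\<close>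

record 'v or_module = "'v monoid" +
  scal :: "complex \<Rightarrow> 'v \<Rightarrow> 'v"
  act :: "or_alg \<Rightarrow> 'v \<Rightarrow> 'v"
  part :: "bool \<Rightarrow> 'v set"

text \<open>The argument \<open>p\<close> is the parity of the generating vector \<open>v\<close>.\<close>

definition verma :: "bool \<Rightarrow> complex \<Rightarrow> complex \<Rightarrow> complex \<Rightarrow> verma_elem or_module" where
  "verma p h1 h2 c1 =
     \<lparr>carrier = carrier (verma_group h1 h2 c1),
      mult = mult (verma_group h1 h2 c1),
      one = one (verma_group h1 h2 c1),
      scal = (\<lambda>c. verma_env_act h1 h2 c1 (env_class (Poly_Mapping.single 0 c))),
      act = (\<lambda>x. verma_env_act h1 h2 c1 (env_class (emb x))),
      part = (\<lambda>i. generate (verma_group h1 h2 c1)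
        {pure_tensor h1 h2 c1 u z | u z. u \<in> env_part (i \<noteq> p)})\<rparr>"

definition graded_submodule :: "'v set \<Rightarrow> 'v or_module \<Rightarrow> bool" where
  "graded_submodule N M \<longleftrightarrow> subgroup N M
     \<and> (\<forall>c. \<forall>n\<in>N. scal M c n \<in> N)
     \<and> (\<forall>x. \<forall>n\<in>N. act M x n \<in> N)
     \<and> (\<forall>n\<in>N. \<exists>n0\<in>N \<inter> part M False. \<exists>n1\<in>N \<inter> part M True. n = n0 \<otimes>\<^bsub>M\<^esub> n1)"

definition reducible :: "'v or_module \<Rightarrow> bool" where
  "reducible M \<longleftrightarrow> (\<exists>N. graded_submodule N M \<and> N \<noteq> {\<one>\<^bsub>M\<^esub>} \<and> N \<noteq> carrier M)"

end

(* Since C_2 acts by zero, G_{-1/2} v is a singular vector of the Verma module M, so it generates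
   a graded submodule M' = U(S) G_{-1/2} v. To see that M' is neither 0 nor M one needs a
   sufficiently large highest weight module, and this can be had without the PBW theorem. Let F be
   spanned by the words in the basis vectors of negative degree; these act on F by left
   multiplication, and the basis vectors of S_0 + S_+ act by moving them to the right through the
   word until they reach v. In F the commutation relations hold as soon as one of the two factors
   lies in S_0 + S_+. The defects of the remaining ones span a subspace (rel_span) that is stable
   under all operators and lives in degrees <= -1, so modulo it the vectors v and G_{-1/2} v of
   degrees 0 and -1/2 survive. The coefficients of these two words therefore descend to
   functionals on M that separate 0, M' and M. *)
theory Submission
  imports Defs
begin

section \<open>Linear extension of maps on a basis\<close>

text \<open>F itself is not an S-module, but computing in F rather than in its quotient keeps every
  step a statement about coefficients of words. Two facts hold exactly in F: S_0 + S_+ acts on v by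
  its character, and the tensors ending in G_{-1/2} are stable under all operators. Stability of
  \<open>rel_span\<close> rests on a Leibniz rule. By the Jacobi identity, z applied to the defect
  of x and y gives the defect of x and y after z, the defects in which x or y is replaced by its
  bracket with z, and terms in which z itself enters a defect. For z in S_0 + S_+ and negative x, y
  the last kind vanishes. The same rule, used by induction on words, shows that S_0 + S_+ acts
  without any defect. The passage to M uses the universal property of the tensor product: an
  additive functional on the tensor algebra descends to M if it kills the ideal that defines U(S)
  and turns right multiplication by U(S_0 + S_+) into multiplication by the character.\<close>

definition pscale :: "complex \<Rightarrow> ('a \<Rightarrow>\<^sub>0 complex) \<Rightarrow> 'a \<Rightarrow>\<^sub>0 complex" where
  "pscale c p = Poly_Mapping.map ((*) c) p"

definition lin :: "(('a \<Rightarrow>\<^sub>0 complex) \<Rightarrow> 'b \<Rightarrow>\<^sub>0 complex) \<Rightarrow> bool" where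
  "lin f \<longleftrightarrow> (\<forall>p q. f (p + q) = f p + f q) \<and> (\<forall>c p. f (pscale c p) = pscale c (f p))"

text \<open>The bracket, the embedding into the tensor algebra and all actions below are linear
  extensions of this kind, so that identities between them reduce to basis vectors by
  \<open>lin_ext\<close>.\<close>

definition lext :: "('a \<Rightarrow> 'b \<Rightarrow>\<^sub>0 complex) \<Rightarrow> ('a \<Rightarrow>\<^sub>0 complex) \<Rightarrow> 'b \<Rightarrow>\<^sub>0 complex" where
  "lext g p = (\<Sum>k\<in>Poly_Mapping.keys p. pscale (Poly_Mapping.lookup p k) (g k))"

lemma lookup_pscale [simp]: "Poly_Mapping.lookup (pscale c p) k = c * Poly_Mapping.lookup p k"
  by (simp add: pscale_def Poly_Mapping.map.rep_eq when_def)

lemma or_scale_eq_pscale: "or_scale = pscale"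
  by (simp add: fun_eq_iff or_scale_def pscale_def)

lemma pscale_simps [simp]:
  "pscale c 0 = 0" "pscale 0 p = 0" "pscale 1 p = p"
  "pscale c (Poly_Mapping.single k a) = Poly_Mapping.single k (c * a)"
  "pscale c (pscale d p) = pscale (c * d) p"
  "pscale c (- p) = - pscale c p" "pscale (- c) p = - pscale c p"
  by (rule poly_mapping_eqI; simp add: lookup_single when_def)+

lemma pscale_add: "pscale c (p + q) = pscale c p + pscale c q"
  by (rule poly_mapping_eqI) (simp add: lookup_add algebra_simps)

lemma pscale_add_left: "pscale (c + d) p = pscale c p + pscale d p"
  by (rule poly_mapping_eqI) (simp add: lookup_add algebra_simps)

lemma pscale_diff: "pscale c (p - q) = pscale c p - pscale c q"
  by (rule poly_mapping_eqI) (simp add: lookup_minus algebra_simps)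

lemma pscale_sum: "pscale c (sum f A) = (\<Sum>a\<in>A. pscale c (f a))"
  by (induction A rule: infinite_finite_induct) (simp_all add: pscale_add)

lemma pscale_mult_left:
  fixes p q :: "'a::monoid_add \<Rightarrow>\<^sub>0 complex"
  shows "pscale c (p * q) = pscale c p * q"
  by (simp add: pscale_def mult_map_scale_conv_mult mult.assoc)

text \<open>Coefficients of a sum may cancel; a common finite index set makes the supports of p, q
  and p + q comparable.\<close>

lemma lext_superset:
  assumes "finite A" "Poly_Mapping.keys p \<subseteq> A"
  shows "lext g p = (\<Sum>k\<in>A. pscale (Poly_Mapping.lookup p k) (g k))"
  unfolding lext_def using assms
  by (intro sum.mono_neutral_left) (auto simp: in_keys_iff)

lemma lext_zero [simp]: "lext g 0 = 0"
  by (simp add: lext_def)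

lemma lext_single [simp]: "lext g (Poly_Mapping.single k c) = pscale c (g k)"
  by (simp add: lext_def)

lemma lext_add: "lext g (p + q) = lext g p + lext g q"
proof -
  let ?A = "Poly_Mapping.keys p \<union> Poly_Mapping.keys q"
  have "lext g (p + q) = (\<Sum>k\<in>?A. pscale (Poly_Mapping.lookup (p + q) k) (g k))"
    by (rule lext_superset) (simp_all add: keys_add)
  then show ?thesis
    by (simp add: lookup_add pscale_add_left sum.distrib lext_superset[of ?A])
qed

lemma lext_pscale: "lext g (pscale c p) = pscale c (lext g p)"
proof -
  have "lext g (pscale c p)
      = (\<Sum>k\<in>Poly_Mapping.keys p. pscale (Poly_Mapping.lookup (pscale c p) k) (g k))"
    by (rule lext_superset) (auto simp: in_keys_iff)
  then show ?thesis
    by (simp add: lext_def pscale_sum)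
qed

lemma lin_lext: "lin (lext g)"
  by (simp add: lin_def lext_add lext_pscale)

lemma lin_add: "lin f \<Longrightarrow> f (p + q) = f p + f q"
  and lin_scale: "lin f \<Longrightarrow> f (pscale c p) = pscale c (f p)"
  by (simp_all add: lin_def)

lemma lin_zero: "lin f \<Longrightarrow> f 0 = 0"
  using lin_scale[of f 0 0] by simp

lemma lin_uminus: "lin f \<Longrightarrow> f (- p) = - f p"
  using lin_scale[of f "- 1" p] by simp

lemma lin_diff: "lin f \<Longrightarrow> f (p - q) = f p - f q"
  using lin_add[of f p "- q"] by (simp add: lin_uminus)

lemma lin_sum: "lin f \<Longrightarrow> f (sum g A) = (\<Sum>a\<in>A. f (g a))"
  by (induction A rule: infinite_finite_induct) (simp_all add: lin_add lin_zero)

lemmas lin_simps = lin_add lin_scale lin_zero lin_uminus lin_diff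

lemma lin_lext_comp: "lin f \<Longrightarrow> f (lext g p) = lext (\<lambda>k. f (g k)) p"
  by (simp add: lext_def lin_sum lin_scale)

lemma lext_single_one: "lext (\<lambda>k. Poly_Mapping.single k 1) p = p"
proof (rule poly_mapping_eqI)
  fix k
  show "Poly_Mapping.lookup (lext (\<lambda>k. Poly_Mapping.single k 1) p) k = Poly_Mapping.lookup p k"
    by (auto simp: lext_def lookup_sum lookup_single when_def not_in_keys_iff_lookup_eq_zero)
qed

lemma lin_ext:
  assumes "lin f" "lin g" "\<And>k. f (Poly_Mapping.single k 1) = g (Poly_Mapping.single k 1)"
  shows "f p = g p"
proof -
  have "f (lext (\<lambda>k. Poly_Mapping.single k 1) p) = g (lext (\<lambda>k. Poly_Mapping.single k 1) p)"
    by (simp add: lin_lext_comp assms)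
  then show ?thesis
    by (simp add: lext_single_one)
qed

lemma lext_cong: "(\<And>k. k \<in> Poly_Mapping.keys p \<Longrightarrow> f k = g k) \<Longrightarrow> lext f p = lext g p"
  by (simp add: lext_def)

lemma lext_fun_add: "lext (\<lambda>k. f k + g k) p = lext f p + lext g p"
  by (simp add: lext_def pscale_add sum.distrib)

lemma lext_fun_diff: "lext (\<lambda>k. f k - g k) p = lext f p - lext g p"
  by (simp add: lext_def pscale_diff sum_subtractf)

lemma lext_fun_scale: "lext (\<lambda>k. pscale c (f k)) p = pscale c (lext f p)"
  by (simp add: lext_def pscale_sum mult.commute)

lemma lext_swap: "lext (\<lambda>a. lext (f a) y) x = lext (\<lambda>b. lext (\<lambda>a. f a b) x) y"
  unfolding lext_def pscale_sum by (subst sum.swap) (simp add: mult.commute)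

lemma lin_id: "lin (\<lambda>p. p)"
  and lin_comp: "lin f \<Longrightarrow> lin g \<Longrightarrow> lin (\<lambda>p. f (g p))"
  and lin_plus: "lin f \<Longrightarrow> lin g \<Longrightarrow> lin (\<lambda>p. f p + g p)"
  and lin_minus: "lin f \<Longrightarrow> lin g \<Longrightarrow> lin (\<lambda>p. f p - g p)"
  and lin_pscale: "lin f \<Longrightarrow> lin (\<lambda>p. pscale c (f p))"
  by (simp_all add: lin_def pscale_add pscale_diff mult.commute)

lemma lin_lext_fun: "(\<And>k. lin (\<lambda>p. f p k)) \<Longrightarrow> lin (\<lambda>p. lext (f p) x)"
proof -
  assume "\<And>k. lin (\<lambda>p. f p k)"
  then have "f (p + q) = (\<lambda>k. f p k + f q k)" "f (pscale c p) = (\<lambda>k. pscale c (f p k))" for c p q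
    by (simp_all add: fun_eq_iff lin_def)
  then show ?thesis
    by (simp add: lin_def lext_fun_add lext_fun_scale)
qed

lemma lin_mult_right:
  fixes q :: "'a::monoid_add \<Rightarrow>\<^sub>0 complex"
  shows "lin (\<lambda>p. p * q)"
  by (simp add: lin_def distrib_right pscale_mult_left)

text \<open>Constants are central: they commute with basis vectors because 0 is neutral in the
  monoid of exponents, hence with everything by linearity.\<close>

lemma pscale_mult_right:
  fixes p q :: "'a::monoid_add \<Rightarrow>\<^sub>0 complex"
  shows "pscale c (p * q) = p * pscale c q"
proof -
  have "lin ((*) (Poly_Mapping.single (0::'a) c))"
    by (simp add: lin_def flip: mult_map_scale_conv_mult pscale_def)
      (simp add: pscale_add mult.commute)
  then have "p * Poly_Mapping.single 0 c = Poly_Mapping.single 0 c * p"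
    by (rule lin_ext[OF lin_mult_right]) (simp add: mult_single)
  then show ?thesis
    by (simp add: pscale_def mult_map_scale_conv_mult flip: mult.assoc)
qed

lemma lin_mult_left:
  fixes q :: "'a::monoid_add \<Rightarrow>\<^sub>0 complex"
  shows "lin (\<lambda>p. q * p)"
  by (simp add: lin_def distrib_left pscale_mult_right)

section \<open>Linear subspaces\<close>

definition lin_subspace :: "('a \<Rightarrow>\<^sub>0 complex) set \<Rightarrow> bool" where
  "lin_subspace V \<longleftrightarrow> 0 \<in> V \<and> (\<forall>p\<in>V. \<forall>q\<in>V. p + q \<in> V) \<and> (\<forall>c. \<forall>p\<in>V. pscale c p \<in> V)"

lemma lin_subspaceD:
  assumes "lin_subspace V"
  shows "0 \<in> V" "p \<in> V \<Longrightarrow> q \<in> V \<Longrightarrow> p + q \<in> V" "p \<in> V \<Longrightarrow> pscale c p \<in> V"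
    "p \<in> V \<Longrightarrow> - p \<in> V" "p \<in> V \<Longrightarrow> q \<in> V \<Longrightarrow> p - q \<in> V"
proof -
  show *: "0 \<in> V" "p \<in> V \<Longrightarrow> q \<in> V \<Longrightarrow> p + q \<in> V" "p \<in> V \<Longrightarrow> pscale c p \<in> V" for p q c
    using assms by (auto simp: lin_subspace_def)
  show **: "p \<in> V \<Longrightarrow> - p \<in> V" for p
    using *(3)[of p "- 1"] by simp
  show "p \<in> V \<Longrightarrow> q \<in> V \<Longrightarrow> p - q \<in> V"
    using *(2)[of p "- q"] **[of q] by simp
qed

lemma lext_in_subspace:
  assumes "lin_subspace V" "\<And>k. k \<in> Poly_Mapping.keys p \<Longrightarrow> g k \<in> V"
  shows "lext g p \<in> V"
proof -
  have "(\<Sum>k\<in>A. pscale (Poly_Mapping.lookup p k) (g k)) \<in> V" if "A \<subseteq> Poly_Mapping.keys p" for A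
    using finite_subset[OF that finite_keys] that
    by (induction A rule: finite_induct) (auto intro: lin_subspaceD[OF assms(1)] assms(2))
  then show ?thesis
    by (simp add: lext_def)
qed


section \<open>Structure constants\<close>

text \<open>The Koszul sign (-1)^(|a||b|), as a complex number so that it can serve as a
  scalar.\<close>

definition ksign :: "or_basis \<Rightarrow> or_basis \<Rightarrow> complex" where
  "ksign a b = (if odd_gen a \<and> odd_gen b then - 1 else 1)"

lemma ksign_square [simp]: "ksign a b * ksign a b = 1" "ksign a b * (ksign a b * c) = c"
  by (simp_all add: ksign_def)

lemma ksign_commute: "ksign a b = ksign b a"
  by (simp add: ksign_def conj_commute)

lemma or_bracket_eq_lext: "or_bracket x y = lext (\<lambda>a. lext (or_struct a) y) x"
  by (simp add: or_bracket_def lext_def or_scale_eq_pscale pscale_sum)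

lemma or_struct_antisym: "or_struct b a = - pscale (ksign a b) (or_struct a b)"
  by (rule poly_mapping_eqI; cases a; cases b)
    (auto simp: ksign_def lookup_add lookup_minus lookup_single when_def field_simps
      dest!: minus_unique)

text \<open>The Jacobi identity in the form that ad z is a superderivation, which is the form
  consumed by \<open>defect_leibniz\<close>. It is checked on all triples of basis vectors.\<close>

lemma or_struct_jacobi:
  "lext (or_struct z) (or_struct x y)
     = lext (\<lambda>a. or_struct a y) (or_struct z x)
       + pscale (ksign z x) (lext (or_struct x) (or_struct z y))"
proof -
  \<comment> \<open>Central terms occur when the indices cancel. Solving this condition for one
    summand turns what remains into polynomial identities.\<close>
  have sum_zero: "a = - (b + c)" if "a + (b + c) = 0" for a b c :: int
    using that by simp
  show ?thesis
    apply (rule poly_mapping_eqI; cases x; cases y; cases z)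
    apply (simp_all add: ksign_def lext_add lin_uminus[OF lin_lext] lin_diff[OF lin_lext]
        if_distrib[of "lext _"] if_distrib[of "\<lambda>p. Poly_Mapping.lookup p _"]
        lookup_add lookup_single when_def add_ac cong: if_cong)
    apply (auto simp: lin_uminus[OF lin_lext] lin_diff[OF lin_lext] lookup_add lookup_minus
        lookup_single when_def algebra_simps power3_eq_cube dest!: sum_zero)
    apply (simp_all add: diff_divide_distrib)
    done
qed

lemma keys_or_struct_parity:
  "c \<in> Poly_Mapping.keys (or_struct a b) \<Longrightarrow> odd_gen c \<longleftrightarrow> odd_gen a \<noteq> odd_gen b"
  by (cases a; cases b)
    (auto split: if_splits simp: in_keys_iff lookup_add lookup_minus lookup_single when_def)

text \<open>The bracket adds parities, so the sign is the same for all terms of a bracket and can be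
  taken out of the sum over them.\<close>

lemma ksign_bracket:
  assumes "c \<in> Poly_Mapping.keys (or_struct a b)"
  shows "ksign d c = ksign d a * ksign d b" "ksign c d = ksign a d * ksign b d"
  using keys_or_struct_parity[OF assms] by (auto simp: ksign_def)

lemma keys_or_struct_borel:
  "a \<in> borel_basis \<Longrightarrow> b \<in> borel_basis \<Longrightarrow> Poly_Mapping.keys (or_struct a b) \<subseteq> borel_basis"
  by (cases a; cases b)
    (auto simp: borel_basis_def image_iff split: if_splits dest!: subsetD[OF keys_add])

text \<open>Letters outside \<open>borel_basis\<close> have degree at most -1/2, so a bracket of two
  of them has degree at most -1, whereas \<open>Gg (- 1)\<close> is G_{-1/2} and central elements
  have degree 0.\<close>

lemma keys_or_struct_neg:
  "a \<notin> borel_basis \<Longrightarrow> b \<notin> borel_basis \<Longrightarrow> c \<in> Poly_Mapping.keys (or_struct a b) \<Longrightarrow>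
    c \<notin> borel_basis \<and> c \<noteq> Gg (- 1)"
  by (cases a; cases b)
    (auto simp: borel_basis_def image_iff split: if_splits dest!: subsetD[OF keys_add])

section \<open>A highest weight module\<close>

abbreviation letter :: "or_basis \<Rightarrow> or_tensor" where
  "letter a \<equiv> Poly_Mapping.single (Wd [a]) 1"

lemma emb_eq_lext: "emb x = lext letter x"
  by (simp add: emb_def lext_def)

lemma letter_mult_word:
  "letter a * Poly_Mapping.single (Wd w) c = Poly_Mapping.single (Wd (a # w)) c"
  by (simp add: mult_single plus_free_word_def)

lemma single_Nil: "Poly_Mapping.single (Wd []) c = Poly_Mapping.single 0 c"
  by (simp add: zero_free_word_def)

text \<open>The weight is a character of S_0 + S_+: a bracket with a component in degree 0 is, up to
  sign, [L_0, W_0] = C_2, and C_2 has weight 0.\<close>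

lemma borel_weight_bracket:
  assumes "a \<in> borel_basis" "b \<in> borel_basis" "c \<in> Poly_Mapping.keys (or_struct a b)"
  shows "hw_act h1 h2 c1 c 1 = 0"
  using assms
  by (cases a; cases b)
    (auto simp: borel_basis_def image_iff hw_act_def split: if_splits dest!: subsetD[OF keys_add])

lemma odd_weight: "odd_gen a \<Longrightarrow> hw_act h1 h2 c1 a 1 = 0"
  by (cases a) (simp_all add: hw_act_def)

context
  fixes h1 h2 c1 :: complex
begin

text \<open>Only words in letters outside \<^const>\<open>borel_basis\<close> matter. On words whose first letter lies in it,
  the operators of \<open>S\<^sub>0 \<oplus> S\<^sub>+\<close> are set to zero, so that their commutation relations need no side
  condition on the word.\<close>

primrec act_word :: "or_basis list \<Rightarrow> or_basis \<Rightarrow> or_tensor" where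
  "act_word [] a =
     (if a \<in> borel_basis then Poly_Mapping.single 0 (hw_act h1 h2 c1 a 1) else letter a)"
| "act_word (y # w) a =
     (if a \<notin> borel_basis then Poly_Mapping.single (Wd (a # y # w)) 1
      else if y \<in> borel_basis then 0
      else pscale (ksign a y) (letter y * act_word w a) + lext (act_word w) (or_struct a y))"

definition gact :: "or_basis \<Rightarrow> or_tensor \<Rightarrow> or_tensor" where
  "gact a f = lext (\<lambda>w. act_word (letters w) a) f"

definition vact :: "or_alg \<Rightarrow> or_tensor \<Rightarrow> or_tensor" where
  "vact x f = lext (\<lambda>a. gact a f) x"

lemma lin_gact: "lin (gact a)"
  unfolding gact_def by (rule lin_lext)

lemma lin_vact: "lin (vact x)"
  unfolding vact_def by (rule lin_lext_fun) (rule lin_gact)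

lemma lin_vact_left: "lin (\<lambda>x. vact x f)"
  unfolding vact_def by (rule lin_lext)

lemma gact_word: "gact a (Poly_Mapping.single (Wd w) 1) = act_word w a"
  by (simp add: gact_def)

lemma gact_neg:
  assumes "a \<notin> borel_basis"
  shows "gact a f = letter a * f"
proof (rule lin_ext[OF lin_gact lin_mult_left])
  fix w :: "or_basis free_word"
  obtain l where "w = Wd l" by (cases w)
  then show "gact a (Poly_Mapping.single w 1) = letter a * Poly_Mapping.single w 1"
    using assms by (cases l) (simp_all add: gact_word letter_mult_word)
qed

lemma gact_one: "a \<in> borel_basis \<Longrightarrow> gact a 1 = Poly_Mapping.single 0 (hw_act h1 h2 c1 a 1)"
  using gact_word[of a "[]"] by (simp add: single_Nil)

section \<open>Defects of the commutation relations\<close>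

definition defect :: "or_basis \<Rightarrow> or_basis \<Rightarrow> or_tensor \<Rightarrow> or_tensor" where
  "defect x y f = gact x (gact y f) - pscale (ksign x y) (gact y (gact x f)) - vact (or_struct x y) f"

lemma lin_defect: "lin (defect x y)"
  unfolding defect_def
  by (intro lin_minus lin_pscale lin_comp[OF lin_gact lin_gact] lin_vact)

lemma defect_antisym: "defect y x f = - pscale (ksign x y) (defect x y f)"
  by (simp add: defect_def or_struct_antisym[of y x] ksign_commute[of y x] pscale_diff
      lin_simps[OF lin_vact_left])

text \<open>On a word this is the recursive clause of \<open>act_word\<close> itself, since
  \<open>gact y\<close> merely prepends y.\<close>

lemma defect_borel_neg:
  assumes "a \<in> borel_basis" "y \<notin> borel_basis"
  shows "defect a y f = 0"
proof -
  have "gact a (gact y f) = pscale (ksign a y) (letter y * gact a f) + vact (or_struct a y) f"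
  proof (rule lin_ext[where f = "\<lambda>f. gact a (gact y f)" and p = f
        and g = "\<lambda>f. pscale (ksign a y) (letter y * gact a f) + vact (or_struct a y) f"])
    show "lin (\<lambda>f. gact a (gact y f))"
      by (rule lin_comp[OF lin_gact lin_gact])
    show "lin (\<lambda>f. pscale (ksign a y) (letter y * gact a f) + vact (or_struct a y) f)"
      by (intro lin_plus lin_pscale lin_comp[OF lin_mult_left lin_gact] lin_vact)
  next
    fix w :: "or_basis free_word"
    obtain l where w: "w = Wd l" by (cases w)
    show "gact a (gact y (Poly_Mapping.single w 1))
      = pscale (ksign a y) (letter y * gact a (Poly_Mapping.single w 1))
        + vact (or_struct a y) (Poly_Mapping.single w 1)"
    proof -
      have "gact y (Poly_Mapping.single (Wd l) 1) = Poly_Mapping.single (Wd (y # l)) 1"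
        using assms by (simp add: gact_neg letter_mult_word)
      then show ?thesis
        using assms by (simp add: w gact_word vact_def)
    qed
  qed
  then show ?thesis
    using assms by (simp add: defect_def gact_neg[of y])
qed

lemma gact_gact:
  "gact x (gact y f)
     = pscale (ksign x y) (gact y (gact x f)) + vact (or_struct x y) f + defect x y f"
  by (simp add: defect_def)

lemma gact_vact: "gact z (vact x f) = lext (\<lambda>a. gact z (gact a f)) x"
  unfolding vact_def by (rule lin_lext_comp[OF lin_gact])

lemma vact_lext: "vact (lext g x) f = lext (\<lambda>a. vact (g a) f) x"
  by (rule lin_lext_comp[OF lin_vact_left])

text \<open>z is moved past each basis vector c of [x,y]; this produces [z,c], hence the iterated
  bracket, and one defect per c.\<close>

lemma gact_bracket:
  "gact z (vact (or_struct x y) f)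
     = pscale (ksign z x * ksign z y) (vact (or_struct x y) (gact z f))
       + vact (lext (or_struct z) (or_struct x y)) f + lext (\<lambda>c. defect z c f) (or_struct x y)"
proof -
  have "gact z (vact (or_struct x y) f)
      = lext (\<lambda>c. pscale (ksign z x * ksign z y) (gact c (gact z f))
          + vact (or_struct z c) f + defect z c f) (or_struct x y)"
    unfolding gact_vact by (intro lext_cong) (metis gact_gact ksign_bracket(1))
  then show ?thesis
    by (simp add: lext_fun_add lext_fun_scale vact_lext vact_def[of _ "gact z f"])
qed

text \<open>z is moved to the right through the three terms of the defect, and the Jacobi identity
  matches the iterated brackets. What spoils the plain Leibniz rule is collected in the last
  bracket, where every defect has z as an entry.\<close>

lemma defect_leibniz:
  "gact z (defect x y f) = pscale (ksign z x * ksign z y) (defect x y (gact z f))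
     + lext (\<lambda>a. defect a y f) (or_struct z x)
     + pscale (ksign z x) (lext (\<lambda>b. defect x b f) (or_struct z y))
     + (pscale (ksign z x) (gact x (defect z y f)) + defect z x (gact y f)
        - pscale (ksign x y) (pscale (ksign z y) (gact y (defect z x f)) + defect z y (gact x f))
        - lext (\<lambda>c. defect z c f) (or_struct x y))"
proof -
  have 1: "gact z (gact x (gact y f)) = pscale (ksign z x * ksign z y) (gact x (gact y (gact z f)))
      + pscale (ksign z x) (gact x (vact (or_struct z y) f))
      + vact (or_struct z x) (gact y f)
      + pscale (ksign z x) (gact x (defect z y f)) + defect z x (gact y f)" for x y
    by (simp add: gact_gact[of z x] gact_gact[of z y] lin_simps[OF lin_gact] pscale_add)
  have 2: "lext (\<lambda>a. defect a y f) (or_struct z x) =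
     vact (or_struct z x) (gact y f) - pscale (ksign z y * ksign x y) (gact y (vact (or_struct z x) f))
     - vact (lext (\<lambda>a. or_struct a y) (or_struct z x)) f"
  proof -
    have "lext (\<lambda>a. defect a y f) (or_struct z x) = lext (\<lambda>a. gact a (gact y f)
       - pscale (ksign z y * ksign x y) (gact y (gact a f)) - vact (or_struct a y) f) (or_struct z x)"
      by (intro lext_cong) (simp add: defect_def ksign_bracket(2))
    then show ?thesis
      by (simp add: lext_fun_diff lext_fun_scale vact_lext gact_vact vact_def[of _ "gact y f"])
  qed
  have 3: "lext (\<lambda>b. defect x b f) (or_struct z y) =
     gact x (vact (or_struct z y) f) - pscale (ksign x z * ksign x y) (vact (or_struct z y) (gact x f))
     - vact (lext (or_struct x) (or_struct z y)) f"
  proof -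
    have "lext (\<lambda>b. defect x b f) (or_struct z y) = lext (\<lambda>b. gact x (gact b f)
       - pscale (ksign x z * ksign x y) (gact b (gact x f)) - vact (or_struct x b) f) (or_struct z y)"
      by (intro lext_cong) (simp add: defect_def ksign_bracket(1))
    then show ?thesis
      by (simp add: lext_fun_diff lext_fun_scale vact_lext gact_vact vact_def[of _ "gact x f"])
  qed
  \<comment> \<open>Multiplying \<open>3\<close> by the outer sign cancels the sign of x and z
    twice, leaving that of x and y.\<close>
  have 4: "ksign z x * (ksign x z * ksign x y) = ksign x y" "ksign x z = ksign z x"
    by (simp_all add: ksign_commute[of x z])
  show ?thesis
    unfolding defect_def[of x y "gact z f"] defect_def[of x y f] 2 3
    by (simp add: 1 4 gact_bracket or_struct_jacobi[of z x y] lin_simps[OF lin_gact] lin_simps[OF lin_vact_left]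
      pscale_add pscale_diff ksign_commute[of y x] mult_ac)
qed

lemma defect_neg_borel: "x \<notin> borel_basis \<Longrightarrow> y \<in> borel_basis \<Longrightarrow> defect x y f = 0"
  using defect_antisym[of y x f] defect_borel_neg[of y x f] by (auto simp: ksign_def split: if_splits)

text \<open>Induction on the word. On v the relation holds because the weight is a character
  vanishing on odd elements. A word starting with a negative z is \<open>gact z\<close> of a shorter
  one; in the Leibniz rule all other terms are either defects on the shorter word with an entry in
  S_0 + S_+ or mixed defects, and so vanish.\<close>

lemma defect_borel_borel:
  assumes "x \<in> borel_basis" "y \<in> borel_basis"
  shows "defect x y f = 0"
proof -
  have *: "defect x y (Poly_Mapping.single (Wd l) 1) = 0"
    if "x \<in> borel_basis" "y \<in> borel_basis" for l x y
    using that
  \<comment> \<open>The pair must vary: the Leibniz rule replaces x and y by components of their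
    brackets with z.\<close>
  proof (induction l arbitrary: x y)
    case Nil
    have *: "gact a (Poly_Mapping.single 0 c) = Poly_Mapping.single 0 (c * hw_act h1 h2 c1 a 1)"
      if "a \<in> borel_basis" for a c
      using lin_scale[OF lin_gact, of a c 1] gact_one[OF that] by (simp flip: single_one)
    have "gact c 1 = 0" if "c \<in> Poly_Mapping.keys (or_struct x y)" for c
      using borel_weight_bracket[OF Nil that] keys_or_struct_borel[OF Nil] that
      by (auto simp: gact_one)
    then have "vact (or_struct x y) 1 = 0"
      by (simp add: vact_def lext_def)
    then have "defect x y (Poly_Mapping.single (Wd []) 1)
        = Poly_Mapping.single 0 (hw_act h1 h2 c1 x 1 * hw_act h1 h2 c1 y 1
            - ksign x y * (hw_act h1 h2 c1 x 1 * hw_act h1 h2 c1 y 1))"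
      using Nil by (simp add: defect_def single_Nil * gact_one mult_ac flip: single_diff)
    also have "\<dots> = 0"
      \<comment> \<open>For two odd elements the sign gives a sum instead of a difference, but then
        both weights are 0.\<close>
      by (cases "odd_gen x \<and> odd_gen y") (auto simp: ksign_def odd_weight)
    finally show ?case .
  next
    case (Cons z l)
    show ?case
    proof (cases "z \<in> borel_basis")
      case True
      have *: "gact a (Poly_Mapping.single (Wd (z # l)) 1) = 0" if "a \<in> borel_basis" for a
        using that True by (simp add: gact_word)
      then have "vact (or_struct x y) (Poly_Mapping.single (Wd (z # l)) 1) = 0"
        unfolding vact_def lext_def using keys_or_struct_borel[OF Cons.prems]
        by (intro sum.neutral) auto
      then show ?thesis
        using Cons.prems by (simp add: defect_def * lin_zero[OF lin_gact])
    next
      case False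
      let ?f = "Poly_Mapping.single (Wd l) 1"
      \<comment> \<open>One entry in S_0 + S_+ suffices: if the other lies there too, the induction
        hypothesis applies, and otherwise the mixed case does.\<close>
      have zero: "defect a b ?f = 0" if "a \<in> borel_basis" for a b
        using that Cons.IH defect_borel_neg by blast
      have zero': "defect a b ?f = 0" if "b \<in> borel_basis" for a b
        using that Cons.IH defect_neg_borel by blast
      have "lext (\<lambda>a. defect a y ?f) (or_struct z x) = 0"
           "lext (\<lambda>b. defect x b ?f) (or_struct z y) = 0"
        using Cons.prems by (simp_all add: lext_def zero zero')
      moreover have "lext (\<lambda>c. defect z c ?f) (or_struct x y) = 0"
        unfolding lext_def using keys_or_struct_borel[OF Cons.prems] defect_neg_borel[OF False]
        by (intro sum.neutral) auto
      moreover have "gact z (defect x y ?f) = 0" "defect x y ?f = 0" "defect z y ?f = 0"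
          "defect z x ?f = 0" "defect z x (gact y ?f) = 0" "defect z y (gact x ?f) = 0"
        using Cons.prems defect_neg_borel[OF False] by (simp_all add: zero lin_zero[OF lin_gact])
      ultimately have "pscale (ksign z x * ksign z y) (defect x y (gact z ?f)) = 0"
        using defect_leibniz[of z x y ?f]
        by (simp only: pscale_simps lin_zero[OF lin_gact] add_0_right diff_0_right)
      then have "defect x y (gact z ?f) = 0"
        by (auto simp: ksign_def split: if_splits)
      then show ?thesis
        using False by (simp add: gact_neg letter_mult_word)
    qed
  qed
  have "defect x y f = lext (\<lambda>_. 0) f"
  proof (rule lin_ext[OF lin_defect lin_lext])
    fix w :: "or_basis free_word"
    show "defect x y (Poly_Mapping.single w 1) = lext (\<lambda>_. 0) (Poly_Mapping.single w 1)"
      using *[OF assms, of "letters w"] by simp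
  qed
  then show ?thesis
    by (simp add: lext_def)
qed

lemma defect_borel: "x \<in> borel_basis \<or> y \<in> borel_basis \<Longrightarrow> defect x y f = 0"
  using defect_borel_borel defect_borel_neg defect_neg_borel by blast

text \<open>The left ideal that the defects generate under negative letters. Only negative letters
  enter the rules, so that degrees can be read off by rule induction; stability under S_0 + S_+ is
  then proved rather than built in.\<close>

inductive_set rel_span :: "or_tensor set" where
  zero: "0 \<in> rel_span"
| add: "p \<in> rel_span \<Longrightarrow> q \<in> rel_span \<Longrightarrow> p + q \<in> rel_span"
| scale: "p \<in> rel_span \<Longrightarrow> pscale c p \<in> rel_span"
| defect: "x \<notin> borel_basis \<Longrightarrow> y \<notin> borel_basis \<Longrightarrow> defect x y f \<in> rel_span"
| left: "a \<notin> borel_basis \<Longrightarrow> p \<in> rel_span \<Longrightarrow> letter a * p \<in> rel_span"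

lemma rel_span_subspace: "lin_subspace rel_span"
  by (simp add: lin_subspace_def rel_span.intros)

lemma defect_in_rel_span: "defect x y f \<in> rel_span"
  by (cases "x \<in> borel_basis \<or> y \<in> borel_basis") (auto simp: defect_borel intro: rel_span.intros)

text \<open>For negative z this is the rule \<open>left\<close>. For z in S_0 + S_+ the correction
  terms of the Leibniz rule vanish, and z passes a negative letter a exactly, leaving [z,a].
  Components of [z,a] may be negative or not, hence the induction over all z at once.\<close>

lemma gact_rel_span: "p \<in> rel_span \<Longrightarrow> gact z p \<in> rel_span"
proof (induction p arbitrary: z rule: rel_span.induct)
  case (defect x y f)
  show ?case
  proof (cases "z \<in> borel_basis")
    case True
    have "lext (\<lambda>a. defect a y f) (or_struct z x) \<in> rel_span"
         "lext (\<lambda>b. defect x b f) (or_struct z y) \<in> rel_span"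
      by (auto intro!: lext_in_subspace[OF rel_span_subspace] defect_in_rel_span)
    moreover have "lext (\<lambda>c. defect z c f) (or_struct x y) = 0"
      using True by (simp add: defect_borel lext_def)
    ultimately show ?thesis
      using True unfolding defect_leibniz[of z x y f]
      by (simp add: defect_borel lin_zero[OF lin_gact])
        (intro rel_span.add rel_span.scale defect_in_rel_span)
  next
    case False
    then show ?thesis
      by (simp add: gact_neg rel_span.left defect_in_rel_span)
  qed
next
  case (left a p)
  show ?case
  proof (cases "z \<in> borel_basis")
    case True
    have "vact (or_struct z a) p \<in> rel_span"
      unfolding vact_def by (auto intro: lext_in_subspace[OF rel_span_subspace] left.IH)
    moreover have "gact z (letter a * p)
        = pscale (ksign z a) (letter a * gact z p) + vact (or_struct z a) p"
      using gact_gact[of z a p] left.hyps by (simp only: defect_borel True gact_neg add_0_right simp_thms)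
    ultimately show ?thesis
      using left by (simp add: rel_span.intros)
  next
    case False
    then show ?thesis
      using left by (simp add: gact_neg rel_span.intros)
  qed
qed (auto simp: lin_simps[OF lin_gact] intro: rel_span.intros)

lemma lookup_letter_mult:
  "Poly_Mapping.lookup (letter a * p) (Wd []) = 0"
  "Poly_Mapping.lookup (letter a * p) (Wd [b]) = (if a = b then Poly_Mapping.lookup p (Wd []) else 0)"
proof -
  have "letter a * p = lext (\<lambda>w. Poly_Mapping.single (Wd (a # letters w)) 1) p"
  proof (rule lin_ext[OF lin_mult_left lin_lext])
    fix w :: "or_basis free_word"
    show "letter a * Poly_Mapping.single w 1
      = lext (\<lambda>w. Poly_Mapping.single (Wd (a # letters w)) 1) (Poly_Mapping.single w 1)"
      by (cases w) (simp add: letter_mult_word)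
  qed
  then have *: "Poly_Mapping.lookup (letter a * p) u
      = (\<Sum>w\<in>Poly_Mapping.keys p. if u = Wd (a # letters w) then Poly_Mapping.lookup p w else 0)" for u
    by (simp add: lext_def lookup_sum lookup_single when_def eq_commute if_distrib cong: if_cong)
  show "Poly_Mapping.lookup (letter a * p) (Wd []) = 0"
    by (simp add: *)
  have "[] = letters w \<longleftrightarrow> w = Wd []" for w :: "or_basis free_word"
    by (cases w) auto
  then show "Poly_Mapping.lookup (letter a * p) (Wd [b])
      = (if a = b then Poly_Mapping.lookup p (Wd []) else 0)"
    by (auto simp: * in_keys_iff)
qed

text \<open>The defect of two letters of negative degree has degree at most \<open>- 1\<close>, which is less than
  the degree of \<open>G\<^bsub>-1/2\<^esub>\<close>.\<close>

lemma lookup_rel_span: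
  "p \<in> rel_span \<Longrightarrow> Poly_Mapping.lookup p (Wd []) = 0 \<and> Poly_Mapping.lookup p (Wd [Gg (- 1)]) = 0"
proof (induction rule: rel_span.induct)
  case (defect x y f)
  let ?V = "{p. Poly_Mapping.lookup p (Wd []) = 0 \<and> Poly_Mapping.lookup p (Wd [Gg (- 1)]) = 0}"
  have V: "lin_subspace ?V"
    by (simp add: lin_subspace_def lookup_add)
  have "vact (or_struct x y) f \<in> ?V"
    unfolding vact_def using keys_or_struct_neg[OF defect]
    by (intro lext_in_subspace[OF V]) (auto simp: gact_neg lookup_letter_mult)
  moreover have "gact x (gact y f) \<in> ?V" "gact y (gact x f) \<in> ?V"
    using defect by (auto simp: gact_neg lookup_letter_mult)
  ultimately have "defect x y f \<in> ?V"
    unfolding defect_def by (intro lin_subspaceD[OF V])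
  then show ?case
    by simp
qed (auto simp: lookup_add lookup_letter_mult)

section \<open>The tensor algebra acting on F\<close>

definition opact :: "or_tensor \<Rightarrow> or_tensor \<Rightarrow> or_tensor" where
  "opact p f = lext (\<lambda>w. foldr gact (letters w) f) p"

lemma lin_opact_left: "lin (\<lambda>p. opact p f)"
  unfolding opact_def by (rule lin_lext)

lemma lin_opact: "lin (opact p)"
proof -
  have "lin (\<lambda>f. foldr gact w f)" for w
    by (induction w) (simp_all add: lin_id lin_comp[OF lin_gact])
  then show ?thesis
    unfolding opact_def by (intro lin_lext_fun)
qed

lemma opact_one: "opact 1 f = f"
  unfolding opact_def single_one[symmetric] by (simp only: lext_single) (simp add: zero_free_word_def)

lemma opact_letter: "opact (letter a) f = gact a f"
  by (simp add: opact_def)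

lemma opact_mult: "opact (p * q) f = opact p (opact q f)"
proof (rule lin_ext[where f = "\<lambda>p. opact (p * q) f"])
  show "lin (\<lambda>p. opact (p * q) f)" "lin (\<lambda>p. opact p (opact q f))"
    by (intro lin_comp[OF lin_opact_left lin_mult_right] lin_opact_left)+
next
  fix u :: "or_basis free_word"
  show "opact (Poly_Mapping.single u 1 * q) f = opact (Poly_Mapping.single u 1) (opact q f)"
  proof (rule lin_ext[where f = "\<lambda>q. opact (Poly_Mapping.single u 1 * q) f"])
    show "lin (\<lambda>q. opact (Poly_Mapping.single u 1 * q) f)"
      "lin (\<lambda>q. opact (Poly_Mapping.single u 1) (opact q f))"
      by (intro lin_comp[OF lin_opact_left lin_mult_left] lin_comp[OF lin_opact lin_opact_left])+
    fix v :: "or_basis free_word"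
    show "opact (Poly_Mapping.single u 1 * Poly_Mapping.single v 1) f
        = opact (Poly_Mapping.single u 1) (opact (Poly_Mapping.single v 1) f)"
      by (simp add: opact_def mult_single plus_free_word_def)
  qed
qed

lemma opact_emb: "opact (emb x) f = vact x f"
  by (simp add: emb_eq_lext lin_lext_comp[OF lin_opact_left] opact_letter vact_def)

lemma opact_rel_span:
  assumes "f \<in> rel_span"
  shows "opact p f \<in> rel_span"
proof -
  have "foldr gact w f \<in> rel_span" for w
    by (induction w) (simp_all add: assms gact_rel_span)
  then show ?thesis
    unfolding opact_def by (intro lext_in_subspace[OF rel_span_subspace])
qed

text \<open>Homogeneity makes the Koszul sign the same for every pair of basis vectors in x and y,
  so the relation acts as a bilinear combination of defects.\<close>

lemma opact_env_relation:
  assumes "x \<in> homog B i" "y \<in> homog B j"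
  shows "opact (emb x * emb y - (if i \<and> j then - 1 else 1) * (emb y * emb x) - emb (or_bracket x y)) f
    \<in> rel_span"
proof -
  define e :: complex where "e = (if i \<and> j then - 1 else 1)"
  have e: "(if i \<and> j then - 1 else 1) * p = pscale e p" for p :: or_tensor
    by (simp add: e_def)
  have sign: "ksign a b = e" if "a \<in> Poly_Mapping.keys x" "b \<in> Poly_Mapping.keys y" for a b
    using assms that by (auto simp: homog_def ksign_def e_def)
  have "vact x (vact y f) = lext (\<lambda>a. lext (\<lambda>b. gact a (gact b f)) y) x"
    unfolding vact_def[of x] gact_vact ..
  moreover have "vact y (vact x f) = lext (\<lambda>a. lext (\<lambda>b. gact b (gact a f)) y) x"
    unfolding vact_def[of y] gact_vact by (rule lext_swap)
  moreover have "vact (or_bracket x y) f = lext (\<lambda>a. lext (\<lambda>b. vact (or_struct a b) f) y) x"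
    by (simp add: or_bracket_eq_lext vact_lext)
  ultimately have "opact (emb x * emb y - pscale e (emb y * emb x) - emb (or_bracket x y)) f
    = lext (\<lambda>a. lext (\<lambda>b. gact a (gact b f) - pscale e (gact b (gact a f)) - vact (or_struct a b) f) y) x"
    by (simp add: lin_simps[OF lin_opact_left] opact_mult opact_emb lext_fun_diff lext_fun_scale)
  also have "\<dots> = lext (\<lambda>a. lext (\<lambda>b. defect a b f) y) x"
    by (intro lext_cong) (simp add: defect_def sign)
  also have "\<dots> \<in> rel_span"
    by (intro lext_in_subspace[OF rel_span_subspace] defect_in_rel_span)
  finally show ?thesis
    unfolding e .
qed

lemma opact_borel_word:
  "set w \<subseteq> borel_basis \<Longrightarrow> foldr gact w 1 = Poly_Mapping.single 0 (foldr (hw_act h1 h2 c1) w 1)"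
proof (induction w)
  case (Cons a w)
  have "gact a (Poly_Mapping.single 0 c) = Poly_Mapping.single 0 (hw_act h1 h2 c1 a c)" for c
    using lin_scale[OF lin_gact, of a c 1] gact_one[of a] Cons.prems
    by (simp add: hw_act_def mult.commute flip: single_one)
  then show ?case
    using Cons by simp
qed simp

lemma opact_borel:
  assumes "q \<in> carrier (tensor_algebra borel_basis)"
  shows "opact q 1 = Poly_Mapping.single 0 (hw_tensor_act h1 h2 c1 q 1)"
proof -
  have "opact q 1 = lext (\<lambda>w. Poly_Mapping.single 0 (foldr (hw_act h1 h2 c1) (letters w) 1)) q"
    unfolding opact_def using assms
    by (intro lext_cong opact_borel_word) (auto simp: tensor_algebra_def)
  also have "\<dots> = (\<Sum>w\<in>Poly_Mapping.keys q. Poly_Mapping.single 0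
      (Poly_Mapping.lookup q w * foldr (hw_act h1 h2 c1) (letters w) 1))"
    by (simp add: lext_def)
  also have "\<dots> = Poly_Mapping.single 0 (hw_tensor_act h1 h2 c1 q 1)"
    unfolding hw_tensor_act_def
    by (rule poly_mapping_eqI) (simp add: lookup_sum lookup_single when_def)
  finally show ?thesis .
qed

lemma hw_tensor_act_scale: "hw_tensor_act h1 h2 c1 q z = hw_tensor_act h1 h2 c1 q 1 * z"
proof -
  have "foldr (hw_act h1 h2 c1) w z = foldr (hw_act h1 h2 c1) w 1 * z" for w
    by (induction w) (simp_all add: hw_act_def)
  then show ?thesis
    unfolding hw_tensor_act_def sum_distrib_right by (metis (no_types) mult.assoc)
qed

text \<open>The case of \<open>G\<^bsub>1/2\<^esub>\<close> is where \<open>C\<^sub>2 v = 0\<close> is needed.\<close>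

lemma singular_vector:
  assumes "a \<in> borel_basis"
  shows "\<exists>c. gact a (letter (Gg (- 1))) = pscale c (letter (Gg (- 1)))"
proof -
  let ?g = "Gg (- 1)"
  have g: "?g \<notin> borel_basis"
    by (auto simp: borel_basis_def)
  have "\<exists>c. vact (or_struct a ?g) 1 = pscale c (letter ?g)"
  proof (cases a)
    case (Lg m)
    then have "m = 0 \<or> m \<ge> 1"
      using assms by (auto simp: borel_basis_def)
    then show ?thesis
    proof
      assume "m = 0"
      \<comment> \<open>The scalar is the index of G_{-1/2}, as [L_0, G_r] = r G_r.\<close>
      then have "vact (or_struct a ?g) 1 = pscale (- 1 / 2) (letter ?g)"
        using g by (simp add: Lg vact_def gact_neg)
      then show ?thesis ..
    next
      assume "m \<ge> 1"
      \<comment> \<open>[L_m, G_{-1/2}] is a multiple of G_{m-1/2}, whose index is positive, so it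
        kills v.\<close>
      then have "Gg (m - 1) \<in> borel_basis"
        by (auto simp: borel_basis_def)
      then have "vact (or_struct a ?g) 1 = pscale 0 (letter ?g)"
        by (simp add: Lg vact_def gact_one hw_act_def)
      then show ?thesis ..
    qed
  next
    case (Gg k)
    then have "k \<ge> 0"
      using assms by (auto simp: borel_basis_def)
    then have "Wg k \<in> borel_basis" "C2g \<in> borel_basis"
      by (auto simp: borel_basis_def image_iff)
    \<comment> \<open>The bracket is k W_k, plus C_2 if k = 0. For k = 0 the factor k removes W_0,
      whatever h_2 is; for k > 0 already W_k kills v.\<close>
    then have "vact (or_struct a ?g) 1 = pscale 0 (letter ?g)"
      by (cases "k = 0") (simp_all add: Gg vact_def lext_add gact_one hw_act_def)
    then show ?thesis ..
  qed (auto simp: vact_def intro: exI[of _ 0])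
  then obtain c where c: "vact (or_struct a ?g) 1 = pscale c (letter ?g)" ..
  have "gact a (letter ?g) = gact a (gact ?g 1)"
    using g by (simp add: gact_neg)
  also have "\<dots> = pscale (ksign a ?g) (gact ?g (gact a 1)) + pscale c (letter ?g)"
    using assms by (simp add: gact_gact[of a ?g] defect_borel c)
  also have "gact ?g (gact a 1) = pscale (hw_act h1 h2 c1 a 1) (letter ?g)"
    using assms g by (simp add: gact_one gact_neg mult_single)
  finally show ?thesis
    by (auto simp flip: pscale_add_left simp del: pscale_simps(4) simp add: pscale_simps(5))
qed

text \<open>Tensors ending in G_{-1/2} are stable under all operators in F itself. On the word
  G_{-1/2} alone this is the singular vector property; an element of S_0 + S_+ is commuted past the
  first letter of a longer word.\<close>

lemma gact_word_end:
  "\<exists>f'. gact a (f * letter (Gg (- 1))) = f' * letter (Gg (- 1))"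
proof -
  let ?G = "letter (Gg (- 1))"
  let ?V = "range (\<lambda>f. f * ?G)"
  have V: "lin_subspace ?V"
    unfolding lin_subspace_def
    by (auto simp: image_iff pscale_mult_left intro: exI[of _ 0]) (metis distrib_right)
  have neg: "gact a (f * ?G) \<in> ?V" if "a \<notin> borel_basis" for a f
    using that by (auto simp: gact_neg mult.assoc[symmetric])
  have "gact a (Poly_Mapping.single (Wd l) 1 * ?G) \<in> ?V" for a l
  proof (induction l arbitrary: a)
    case Nil
    show ?case
    proof (cases "a \<in> borel_basis")
      case True
      then obtain c where "gact a ?G = pscale c ?G"
        using singular_vector by blast
      then have "gact a (Poly_Mapping.single (Wd []) 1 * ?G) = Poly_Mapping.single 0 c * ?G"
        by (simp add: single_Nil mult_single)
      then show ?thesis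
        by blast
    qed (simp add: neg)
  next
    case (Cons z l)
    let ?p = "Poly_Mapping.single (Wd l) 1 * ?G"
    consider "a \<notin> borel_basis" | "a \<in> borel_basis" "z \<in> borel_basis"
      | "a \<in> borel_basis" "z \<notin> borel_basis" by blast
    then show ?case
    proof cases
      case 1
      then show ?thesis by (rule neg)
    next
      \<comment> \<open>Here the convention on words that start with a letter of
        \<open>borel_basis\<close> gives 0.\<close>
      case 2
      then show ?thesis
        by (simp add: mult_single plus_free_word_def gact_word lin_subspaceD[OF V])
    next
      case 3
      have z: "Poly_Mapping.single (Wd (z # l)) 1 * ?G = gact z ?p"
        using 3 by (simp add: gact_neg letter_mult_word flip: mult.assoc)
      have "gact z (gact a ?p) \<in> ?V"
        using Cons.IH[of a] neg[OF 3(2)] by auto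
      moreover have "vact (or_struct a z) ?p \<in> ?V"
        unfolding vact_def using Cons.IH by (intro lext_in_subspace[OF V])
      ultimately show ?thesis
        unfolding z gact_gact[of a z ?p] using 3
        by (simp add: defect_borel) (intro lin_subspaceD[OF V])
    qed
  qed
  then have "gact a (Poly_Mapping.single w 1 * ?G) \<in> ?V" for w
    by (cases w) simp
  then have "lext (\<lambda>w. gact a (Poly_Mapping.single w 1 * ?G)) f \<in> ?V"
    by (intro lext_in_subspace[OF V])
  also have "lext (\<lambda>w. gact a (Poly_Mapping.single w 1 * ?G)) f
      = gact a (lext (\<lambda>w. Poly_Mapping.single w 1) f * ?G)"
    by (simp only: lin_lext_comp[OF lin_comp[OF lin_gact lin_mult_right]])
  finally show ?thesis
    by (auto simp: lext_single_one)
qed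

text \<open>Every word that occurs ends in G_{-1/2}, so none of them is empty.\<close>

lemma lookup_opact_singular: "Poly_Mapping.lookup (opact q (letter (Gg (- 1)))) (Wd []) = 0"
proof -
  let ?G = "letter (Gg (- 1))"
  have "\<exists>f. foldr gact w ?G = f * ?G" for w
    by (induction w) (metis foldr.simps(1) id_apply mult_1, metis gact_word_end foldr.simps(2) o_apply)
  then have "Poly_Mapping.lookup (foldr gact w ?G) (Wd []) = 0" for w
  proof -
    obtain f where f: "foldr gact w ?G = f * ?G"
      using \<open>\<And>w. \<exists>f. foldr gact w ?G = f * ?G\<close> by blast
    have "Wd [] \<notin> Poly_Mapping.keys (f * ?G)"
      using keys_mult[of f ?G] by (auto simp: plus_free_word_def)
    then show ?thesis
      by (simp add: f in_keys_iff)
  qed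
  then show ?thesis
    by (simp add: opact_def lext_def lookup_sum)
qed

end

section \<open>Enveloping algebras\<close>

lemma tensor_algebra_simps [simp]:
  "mult (tensor_algebra B) = (*)" "one (tensor_algebra B) = 1"
  "ring.zero (tensor_algebra B) = 0" "add (tensor_algebra B) = (+)"
  by (simp_all add: tensor_algebra_def)

lemma carrier_tensor_algebra_UNIV [simp]: "carrier (tensor_algebra UNIV) = UNIV"
  by (simp add: tensor_algebra_def)

lemma uminus_tensor_algebra:
  assumes "p \<in> carrier (tensor_algebra B)"
  shows "- p \<in> carrier (tensor_algebra B)" "\<ominus>\<^bsub>tensor_algebra B\<^esub> p = - p"
proof -
  interpret ring "tensor_algebra B" by (rule tensor_algebra_ring)
  show *: "- p \<in> carrier (tensor_algebra B)"
    using assms by (simp add: tensor_algebra_def)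
  show "\<ominus>\<^bsub>tensor_algebra B\<^esub> p = - p"
    by (rule minus_equality) (use assms * in auto)
qed

lemma tensor_algebra_idealI:
  assumes "I \<subseteq> carrier (tensor_algebra B)" "0 \<in> I"
    and "\<And>p q. p \<in> I \<Longrightarrow> q \<in> I \<Longrightarrow> p + q \<in> I" "\<And>p. p \<in> I \<Longrightarrow> - p \<in> I"
    and "\<And>p q. p \<in> I \<Longrightarrow> q \<in> carrier (tensor_algebra B) \<Longrightarrow> q * p \<in> I"
    and "\<And>p q. p \<in> I \<Longrightarrow> q \<in> carrier (tensor_algebra B) \<Longrightarrow> p * q \<in> I"
  shows "ideal I (tensor_algebra B)"
proof (rule idealI[OF tensor_algebra_ring])
  show "subgroup I (add_monoid (tensor_algebra B))"
  proof (rule subgroup.intro)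
    show "inv\<^bsub>add_monoid (tensor_algebra B)\<^esub> p \<in> I" if "p \<in> I" for p
      using uminus_tensor_algebra(2)[of p B] assms(1,4) that by (auto simp: a_inv_def)
  qed (use assms in auto)
qed (use assms in auto)

text \<open>This places the generators \<open>env_relations B\<close> in the tensor algebra over B,
  as required for the ideal they generate.\<close>

definition bracket_closed :: "or_basis set \<Rightarrow> bool" where
  "bracket_closed B \<longleftrightarrow> (\<forall>a\<in>B. \<forall>b\<in>B. Poly_Mapping.keys (or_struct a b) \<subseteq> B)"

lemma bracket_closed_UNIV: "bracket_closed UNIV"
  by (simp add: bracket_closed_def)

lemma bracket_closed_borel: "bracket_closed borel_basis"
  unfolding bracket_closed_def using keys_or_struct_borel by blast

lemma lin_subspace_keys: "lin_subspace {p. Poly_Mapping.keys p \<subseteq> A}"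
proof -
  have "Poly_Mapping.keys (pscale c p) \<subseteq> Poly_Mapping.keys p" for c p
    by (auto simp: in_keys_iff)
  then have "Poly_Mapping.keys (pscale c p) \<subseteq> A" if "Poly_Mapping.keys p \<subseteq> A" for c p
    using that by (rule subset_trans)
  moreover have "Poly_Mapping.keys (p + q) \<subseteq> A"
    if "Poly_Mapping.keys p \<subseteq> A" "Poly_Mapping.keys q \<subseteq> A" for p q :: "'a \<Rightarrow>\<^sub>0 complex"
    by (rule subset_trans[OF keys_add]) (simp add: that)
  ultimately show ?thesis
    by (simp add: lin_subspace_def)
qed

lemma lin_subspace_tensor_algebra: "lin_subspace (carrier (tensor_algebra B))"
proof -
  have "carrier (tensor_algebra B) = {p. Poly_Mapping.keys p \<subseteq> {w. set (letters w) \<subseteq> B}}"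
    by (auto simp: tensor_algebra_def)
  then show ?thesis
    by (simp only: lin_subspace_keys)
qed

lemma env_relations_carrier:
  assumes "bracket_closed B"
  shows "env_relations B \<subseteq> carrier (tensor_algebra B)"
proof
  fix p assume "p \<in> env_relations B"
  then obtain x y i j where p: "p = emb x * emb y - (if i \<and> j then - 1 else 1) * (emb y * emb x)
      - emb (or_bracket x y)" and xy: "x \<in> homog B i" "y \<in> homog B j"
    by (auto simp: env_relations_def)
  note sub = lin_subspaceD[OF lin_subspace_tensor_algebra[of B]]
  have emb: "emb x \<in> carrier (tensor_algebra B)" if "Poly_Mapping.keys x \<subseteq> B" for x
    unfolding emb_eq_lext using that
    by (intro lext_in_subspace lin_subspace_tensor_algebra) (auto simp: tensor_algebra_def)
  have mult: "q * r \<in> carrier (tensor_algebra B)"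
    if "q \<in> carrier (tensor_algebra B)" "r \<in> carrier (tensor_algebra B)" for q r
    using monoid.m_closed[OF ring.is_monoid[OF tensor_algebra_ring] that] by simp
  have keys: "Poly_Mapping.keys x \<subseteq> B" "Poly_Mapping.keys y \<subseteq> B"
    using xy by (auto simp: homog_def)
  have "or_bracket x y \<in> {z. Poly_Mapping.keys z \<subseteq> B}"
    unfolding or_bracket_eq_lext using assms keys
    by (intro lext_in_subspace lin_subspace_keys) (auto simp: bracket_closed_def)
  then have "emb (or_bracket x y) \<in> carrier (tensor_algebra B)"
    by (simp add: emb)
  moreover have "emb x * emb y \<in> carrier (tensor_algebra B)"
      "emb y * emb x \<in> carrier (tensor_algebra B)"
    using keys by (simp_all add: emb mult)
  ultimately show "p \<in> carrier (tensor_algebra B)"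
    unfolding p by (cases "i \<and> j") (simp_all add: sub)
qed

lemma env_ideal_ideal: "bracket_closed B \<Longrightarrow> ideal (env_ideal B) (tensor_algebra B)"
  unfolding env_ideal_def
  by (intro ring.genideal_ideal tensor_algebra_ring env_relations_carrier)

lemmas env_ideal_UNIV = env_ideal_ideal[OF bracket_closed_UNIV]

lemma env_ideal_minimal:
  "ideal I (tensor_algebra B) \<Longrightarrow> env_relations B \<subseteq> I \<Longrightarrow> env_ideal B \<subseteq> I"
  unfolding env_ideal_def by (rule ring.genideal_minimal[OF tensor_algebra_ring])

lemma env_ideal_closed:
  assumes "bracket_closed B"
  shows "0 \<in> env_ideal B"
    "p \<in> env_ideal B \<Longrightarrow> q \<in> env_ideal B \<Longrightarrow> p + q \<in> env_ideal B"
    "p \<in> env_ideal B \<Longrightarrow> - p \<in> env_ideal B"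
    "p \<in> env_ideal B \<Longrightarrow> q \<in> env_ideal B \<Longrightarrow> p - q \<in> env_ideal B"
    "p \<in> env_ideal B \<Longrightarrow> p \<in> carrier (tensor_algebra B)"
    "p \<in> env_ideal B \<Longrightarrow> r \<in> carrier (tensor_algebra B) \<Longrightarrow> r * p \<in> env_ideal B"
    "p \<in> env_ideal B \<Longrightarrow> r \<in> carrier (tensor_algebra B) \<Longrightarrow> p * r \<in> env_ideal B"
proof -
  interpret ideal "env_ideal B" "tensor_algebra B"
    by (rule env_ideal_ideal[OF assms])
  show "0 \<in> env_ideal B"
    using additive_subgroup.zero_closed[OF additive_subgroup_axioms] by simp
  show add: "p + q \<in> env_ideal B" if "p \<in> env_ideal B" "q \<in> env_ideal B" for p q
    using additive_subgroup.a_closed[OF additive_subgroup_axioms that] by simp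
  show carr: "p \<in> carrier (tensor_algebra B)" if "p \<in> env_ideal B" for p
    using a_subset that by auto
  show minus: "- p \<in> env_ideal B" if "p \<in> env_ideal B" for p
    using additive_subgroup.a_inv_closed[OF additive_subgroup_axioms that] uminus_tensor_algebra(2)[OF carr[OF that]] by simp
  show "p \<in> env_ideal B \<Longrightarrow> q \<in> env_ideal B \<Longrightarrow> p - q \<in> env_ideal B"
    using add[of p "- q"] minus by simp
  show "p \<in> env_ideal B \<Longrightarrow> r \<in> carrier (tensor_algebra B) \<Longrightarrow> r * p \<in> env_ideal B"
    "p \<in> env_ideal B \<Longrightarrow> r \<in> carrier (tensor_algebra B) \<Longrightarrow> p * r \<in> env_ideal B"
    using I_l_closed I_r_closed by simp_all
qed

lemmas env_ideal_UNIV_closed = env_ideal_closed[OF bracket_closed_UNIV, simplified]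

lemma opact_env_ideal:
  assumes "p \<in> env_ideal UNIV"
  shows "opact h1 h2 c1 p f \<in> rel_span h1 h2 c1"
proof -
  \<comment> \<open>The quantifier over f makes this a right ideal, and stability of
    \<open>rel_span\<close> makes it a left ideal.\<close>
  let ?I = "{p. \<forall>f. opact h1 h2 c1 p f \<in> rel_span h1 h2 c1}"
  note V = lin_subspaceD[OF rel_span_subspace[of h1 h2 c1]]
  have "ideal ?I (tensor_algebra UNIV)"
    by (rule tensor_algebra_idealI)
      (auto simp: lin_simps[OF lin_opact_left] opact_mult intro: V opact_rel_span)
  moreover have "env_relations UNIV \<subseteq> ?I"
  proof
    fix p assume "p \<in> env_relations UNIV"
    then obtain x y i j where "x \<in> homog UNIV i" "y \<in> homog UNIV j"
      "p = emb x * emb y - (if i \<and> j then - 1 else 1) * (emb y * emb x) - emb (or_bracket x y)"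
      unfolding env_relations_def by blast
    then show "p \<in> ?I"
      by (simp only: mem_Collect_eq opact_env_relation simp_thms)
  qed
  ultimately show ?thesis
    using env_ideal_minimal assms by blast
qed

section \<open>Comparing U(S_0 + S_+) with U(S)\<close>

lemma env_ideal_borel_subset: "env_ideal borel_basis \<subseteq> env_ideal UNIV"
proof -
  let ?T = "tensor_algebra borel_basis" and ?I = "carrier (tensor_algebra borel_basis) \<inter> env_ideal UNIV"
  have mult: "q * r \<in> carrier ?T" if "q \<in> carrier ?T" "r \<in> carrier ?T" for q r
    using monoid.m_closed[OF ring.is_monoid[OF tensor_algebra_ring] that] by simp
  note sub = lin_subspaceD[OF lin_subspace_tensor_algebra]
  have "ideal ?I ?T"
    by (rule tensor_algebra_idealI) (auto intro: env_ideal_UNIV_closed mult sub)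
  moreover have "homog borel_basis i \<subseteq> homog UNIV i" for i
    by (auto simp: homog_def)
  then have "env_relations borel_basis \<subseteq> env_relations UNIV"
    unfolding env_relations_def by blast
  moreover have "env_relations UNIV \<subseteq> env_ideal UNIV"
    unfolding env_ideal_def
    by (rule ring.genideal_self[OF tensor_algebra_ring env_relations_carrier[OF bracket_closed_UNIV]])
  ultimately show ?thesis
    using env_ideal_minimal[of ?I borel_basis] env_relations_carrier[OF bracket_closed_borel]
    by blast
qed

lemma env_ideal_coset:
  assumes "bracket_closed B"
  shows "x \<in> env_ideal B +>\<^bsub>tensor_algebra B\<^esub> p \<longleftrightarrow> x - p \<in> env_ideal B"
  by (auto simp: a_r_coset_def' intro!: bexI[of _ "x - p"])

lemma env_class_iff: "x \<in> env_class p \<longleftrightarrow> x - p \<in> env_ideal UNIV"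
  unfolding env_class_def by (rule env_ideal_coset[OF bracket_closed_UNIV])

lemma env_class_eq_iff: "env_class p = env_class q \<longleftrightarrow> p - q \<in> env_ideal UNIV"
proof
  show "env_class p = env_class q \<Longrightarrow> p - q \<in> env_ideal UNIV"
    using env_ideal_UNIV_closed(1) by (metis cancel_comm_monoid_add_class.diff_cancel env_class_iff)
next
  assume *: "p - q \<in> env_ideal UNIV"
  have "x - q = (x - p) + (p - q)" "x - p = (x - q) - (p - q)" for x
    by simp_all
  then have "x - p \<in> env_ideal UNIV \<longleftrightarrow> x - q \<in> env_ideal UNIV" for x
    using * env_ideal_UNIV_closed(2,4) by metis
  then show "env_class p = env_class q"
    by (auto simp: env_class_iff)
qed

lemma U_S_simps [simp]:
  "env_class p \<otimes>\<^bsub>U_S\<^esub> env_class q = env_class (p * q)"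
  "env_class p \<oplus>\<^bsub>U_S\<^esub> env_class q = env_class (p + q)"
  "carrier U_S = range env_class"
proof -
  interpret ideal "env_ideal UNIV" "tensor_algebra UNIV"
    by (rule env_ideal_UNIV)
  show "env_class p \<otimes>\<^bsub>U_S\<^esub> env_class q = env_class (p * q)"
    using rcoset_mult_add[of p q] by (simp add: enveloping_def FactRing_def env_class_def)
  show "env_class p \<oplus>\<^bsub>U_S\<^esub> env_class q = env_class (p + q)"
    using a_rcos_sum[of p q] by (simp add: enveloping_def FactRing_def env_class_def)
  show "carrier U_S = range env_class"
    by (auto simp: enveloping_def FactRing_def A_RCOSETS_def' env_class_def)
qed

lemma carrier_U_b:
  "carrier U_b = (+>\<^bsub>tensor_algebra borel_basis\<^esub>) (env_ideal borel_basis) ` carrier (tensor_algebra borel_basis)"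
  unfolding enveloping_def FactRing_def A_RCOSETS_def' by (simp add: image_def) blast

text \<open>The union defining \<open>env_incl\<close> runs over equal cosets, because the smaller
  ideal lies in the larger one.\<close>

lemma env_incl_coset: "env_incl (env_ideal borel_basis +>\<^bsub>tensor_algebra borel_basis\<^esub> q) = env_class q"
proof -
  let ?b = "env_ideal borel_basis +>\<^bsub>tensor_algebra borel_basis\<^esub> q"
  have "env_class p = env_class q" if "p \<in> ?b" for p
    using that env_ideal_borel_subset env_ideal_coset[OF bracket_closed_borel]
    by (auto simp: env_class_eq_iff)
  moreover have "q \<in> ?b"
    by (simp add: env_ideal_coset env_ideal_closed bracket_closed_borel)
  ultimately show ?thesis
    unfolding env_incl_def by (metis (no_types, lifting) UN_constant_eq)
qed

text \<open>The character value of q is the coefficient of v in q v, computed in F; elements of the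
  ideal send v into \<open>rel_span\<close>, where this coefficient is 0.\<close>

lemma hw_tensor_act_env_ideal:
  assumes "p \<in> carrier (tensor_algebra borel_basis)" "q \<in> carrier (tensor_algebra borel_basis)"
    "p - q \<in> env_ideal UNIV"
  shows "hw_tensor_act h1 h2 c1 p z = hw_tensor_act h1 h2 c1 q z"
proof -
  have "Poly_Mapping.lookup (opact h1 h2 c1 (p - q) 1) (Wd []) = 0"
    using lookup_rel_span[OF opact_env_ideal[OF assms(3), of h1 h2 c1]] by simp
  then have "hw_tensor_act h1 h2 c1 p 1 = hw_tensor_act h1 h2 c1 q 1"
    using assms(1,2)
    by (simp add: lin_simps[OF lin_opact_left] opact_borel lookup_minus zero_free_word_def)
  then show ?thesis
    unfolding hw_tensor_act_scale[of _ _ _ p z] hw_tensor_act_scale[of _ _ _ q z] by simp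
qed

lemma hw_env_act_coset:
  assumes "q \<in> carrier (tensor_algebra borel_basis)"
  shows "hw_env_act h1 h2 c1 (env_ideal borel_basis +>\<^bsub>tensor_algebra borel_basis\<^esub> q) z
    = hw_tensor_act h1 h2 c1 q z"
proof -
  let ?b = "env_ideal borel_basis +>\<^bsub>tensor_algebra borel_basis\<^esub> q"
  have "hw_tensor_act h1 h2 c1 p z = hw_tensor_act h1 h2 c1 q z" if "p \<in> ?b" for p
  proof (rule hw_tensor_act_env_ideal[OF _ assms])
    have "p - q \<in> env_ideal borel_basis"
      using that by (simp add: env_ideal_coset bracket_closed_borel)
    then show "p - q \<in> env_ideal UNIV" "p \<in> carrier (tensor_algebra borel_basis)"
      using env_ideal_borel_subset env_ideal_closed(5)[OF bracket_closed_borel]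
        lin_subspaceD(2)[OF lin_subspace_tensor_algebra, of "p - q" _ q] assms by auto
  qed
  moreover have "q \<in> ?b"
    by (simp add: env_ideal_coset env_ideal_closed bracket_closed_borel)
  ultimately have "(\<lambda>p. hw_tensor_act h1 h2 c1 p z) ` ?b = {hw_tensor_act h1 h2 c1 q z}"
    by blast
  then show ?thesis
    by (simp add: hw_env_act_def)
qed

section \<open>The Verma module as a cyclic module\<close>

context
  fixes h1 h2 c1 :: complex
begin

abbreviation chi :: "or_tensor \<Rightarrow> complex \<Rightarrow> complex" where
  "chi \<equiv> hw_tensor_act h1 h2 c1"

abbreviation gen :: "or_tensor \<Rightarrow> complex \<Rightarrow> or_tensor set \<times> complex \<Rightarrow>\<^sub>0 int" where
  "gen p z \<equiv> frag_of (env_class p, z)"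

abbreviation rels :: verma_elem where
  "rels \<equiv> verma_rels h1 h2 c1"

abbreviation free :: "(or_tensor set \<times> complex \<Rightarrow>\<^sub>0 int) monoid" where
  "free \<equiv> tensor_free U_S"

text \<open>The relations of the tensor product in terms of representatives: tensors p and q instead
  of cosets, and the character instead of the action of U(S_0 + S_+).\<close>

definition verma_gens :: verma_elem where
  "verma_gens = {gen (p + p') z - gen p z - gen p' z | p p' z. True}
    \<union> {gen p (z + z') - gen p z - gen p z' | p z z'. True}
    \<union> {gen (p * q) z - gen p (chi q z) | p q z. q \<in> carrier (tensor_algebra borel_basis)}"

lemma verma_gensI:
  "gen (p + p') z - gen p z - gen p' z \<in> verma_gens"
  "gen p (z + z') - gen p z - gen p z' \<in> verma_gens"
  "q \<in> carrier (tensor_algebra borel_basis) \<Longrightarrow> gen (p * q) z - gen p (chi q z) \<in> verma_gens"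
  unfolding verma_gens_def by blast+

lemma verma_gensE:
  assumes "x \<in> verma_gens"
  obtains (add_left) p p' z where "x = gen (p + p') z - gen p z - gen p' z"
    | (add_right) p z z' where "x = gen p (z + z') - gen p z - gen p z'"
    | (balance) p q z where "q \<in> carrier (tensor_algebra borel_basis)" "x = gen (p * q) z - gen p (chi q z)"
  using assms unfolding verma_gens_def by blast

lemma verma_rels_eq: "rels = generate free verma_gens"
proof -
  have 1: "{frag_of (m \<oplus>\<^bsub>U_S\<^esub> m', n) - frag_of (m, n) - frag_of (m', n)
         | m m' n. m \<in> carrier U_S \<and> m' \<in> carrier U_S}
      = {gen (p + p') z - gen p z - gen p' z | p p' z. True}"
    (is "?A = ?B")
  proof
    show "?A \<subseteq> ?B"
      by (clarsimp; blast)
    show "?B \<subseteq> ?A"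
    proof clarify
      fix p p' z
      show "\<exists>m m' n. gen (p + p') z - gen p z - gen p' z
          = frag_of (m \<oplus>\<^bsub>U_S\<^esub> m', n) - frag_of (m, n) - frag_of (m', n)
          \<and> m \<in> carrier U_S \<and> m' \<in> carrier U_S"
        by (intro exI[of _ "env_class p"] exI[of _ "env_class p'"] exI[of _ z]) simp
    qed
  qed
  have 2: "{frag_of (m, n + n') - frag_of (m, n) - frag_of (m, n') | m n n'. m \<in> carrier U_S}
      = {gen p (z + z') - gen p z - gen p z' | p z z'. True}"
    by auto
  have 3: "{frag_of (right_act m r, n) - frag_of (m, hw_env_act h1 h2 c1 r n)
        | m r n. m \<in> carrier U_S \<and> r \<in> carrier U_b}
      = {gen (p * q) z - gen p (chi q z) | p q z. q \<in> carrier (tensor_algebra borel_basis)}"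
    (is "?A = ?B")
  proof
    show "?A \<subseteq> ?B"
      unfolding carrier_U_b
      by (clarsimp simp: right_act_def env_incl_coset hw_env_act_coset; blast)
    show "?B \<subseteq> ?A"
    proof clarify
      fix p q z assume q: "q \<in> carrier (tensor_algebra borel_basis)"
      let ?q = "env_ideal borel_basis +>\<^bsub>tensor_algebra borel_basis\<^esub> q"
      show "\<exists>m r n. gen (p * q) z - gen p (chi q z)
          = frag_of (right_act m r, n) - frag_of (m, hw_env_act h1 h2 c1 r n)
          \<and> m \<in> carrier U_S \<and> r \<in> carrier U_b"
        using q by (intro exI[of _ "env_class p"] exI[of _ ?q] exI[of _ z])
          (simp add: right_act_def env_incl_coset hw_env_act_coset carrier_U_b)
    qed
  qed
  show ?thesis
    unfolding verma_rels_def tensor_rels_def verma_gens_def 1 2 3 ..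
qed

section \<open>The free abelian group and its relations\<close>

lemma carrier_free: "x \<in> carrier free \<longleftrightarrow> Poly_Mapping.keys x \<subseteq> range env_class \<times> UNIV"
  by (simp add: tensor_free_def)

lemma free_simps [simp]: "x \<otimes>\<^bsub>free\<^esub> y = x + y" "\<one>\<^bsub>free\<^esub> = 0"
  by (simp_all add: tensor_free_def)

lemma comm_group_free: "comm_group free"
  by (simp add: tensor_free_def abelian_free_Abelian_group)

lemma group_free: "group free"
  using comm_group_free by (rule comm_group.axioms)

lemma inv_free: "x \<in> carrier free \<Longrightarrow> inv\<^bsub>free\<^esub> x = - x"
  by (simp add: tensor_free_def)

lemma gen_carrier: "gen p z \<in> carrier free"
  by (simp add: carrier_free keys_frag_of)

lemma free_closed:
  "x \<in> carrier free \<Longrightarrow> y \<in> carrier free \<Longrightarrow> x + y \<in> carrier free"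
  "x \<in> carrier free \<Longrightarrow> - x \<in> carrier free"
  "x \<in> carrier free \<Longrightarrow> y \<in> carrier free \<Longrightarrow> x - y \<in> carrier free"
proof -
  show *: "x + y \<in> carrier free" if "x \<in> carrier free" "y \<in> carrier free" for x y
    using monoid.m_closed[OF group.is_monoid[OF group_free] that] by simp
  show **: "- x \<in> carrier free" if "x \<in> carrier free" for x
    using group.inv_closed[OF group_free that] inv_free[OF that] by simp
  show "x \<in> carrier free \<Longrightarrow> y \<in> carrier free \<Longrightarrow> x - y \<in> carrier free"
    using *[of x "- y"] ** by simp
qed

lemma subgroup_freeI:
  assumes "H \<subseteq> carrier free" "0 \<in> H" "\<And>x y. x \<in> H \<Longrightarrow> y \<in> H \<Longrightarrow> x + y \<in> H" "\<And>x. x \<in> H \<Longrightarrow> - x \<in> H"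
  shows "subgroup H free"
  by (rule subgroup.intro) (use assms inv_free in auto)

lemma verma_gens_carrier: "verma_gens \<subseteq> carrier free"
  unfolding verma_gens_def by (auto intro!: free_closed gen_carrier)

lemma subgroup_rels: "subgroup rels free"
  unfolding verma_rels_eq
  by (rule group.generate_is_subgroup[OF group_free verma_gens_carrier])

lemma rels_minimal: "subgroup H free \<Longrightarrow> verma_gens \<subseteq> H \<Longrightarrow> rels \<subseteq> H"
  unfolding verma_rels_eq by (rule group.generate_subgroup_incl[OF group_free])

lemma verma_gens_rels: "verma_gens \<subseteq> rels"
  unfolding verma_rels_eq by (auto intro: generate.incl)

lemma rels_closed:
  "0 \<in> rels" "x \<in> rels \<Longrightarrow> y \<in> rels \<Longrightarrow> x + y \<in> rels" "x \<in> rels \<Longrightarrow> - x \<in> rels"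
  "x \<in> rels \<Longrightarrow> y \<in> rels \<Longrightarrow> x - y \<in> rels" "x \<in> rels \<Longrightarrow> x \<in> carrier free"
proof -
  interpret subgroup rels free by (rule subgroup_rels)
  show "0 \<in> rels" using one_closed by simp
  show *: "x + y \<in> rels" if "x \<in> rels" "y \<in> rels" for x y
    using m_closed[OF that] by simp
  show carr: "x \<in> carrier free" if "x \<in> rels" for x
    using subset that by auto
  show **: "- x \<in> rels" if "x \<in> rels" for x
    using m_inv_closed[OF that] inv_free[OF carr[OF that]] by simp
  show "x \<in> rels \<Longrightarrow> y \<in> rels \<Longrightarrow> x - y \<in> rels"
    using *[of x "- y"] ** by simp
qed

lemma mem_coset: "y \<in> rels #>\<^bsub>free\<^esub> x \<longleftrightarrow> y - x \<in> rels"
  by (auto simp: r_coset_def intro!: bexI[of _ "y - x"])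

lemma coset_eq_iff: "rels #>\<^bsub>free\<^esub> x = rels #>\<^bsub>free\<^esub> y \<longleftrightarrow> x - y \<in> rels"
proof
  show "rels #>\<^bsub>free\<^esub> x = rels #>\<^bsub>free\<^esub> y \<Longrightarrow> x - y \<in> rels"
    using rels_closed(1) mem_coset[of x x] mem_coset[of x y] by auto
next
  assume *: "x - y \<in> rels"
  have "z - x \<in> rels \<longleftrightarrow> z - y \<in> rels" for z
    using rels_closed(2)[OF _ *, of "z - x"] rels_closed(4)[OF _ *, of "z - y"] by auto
  then show "rels #>\<^bsub>free\<^esub> x = rels #>\<^bsub>free\<^esub> y"
    by (auto simp: mem_coset)
qed

text \<open>The element p v of the Verma module. All elements turn out to be of this form, so the
  module is handled as a quotient of the tensor algebra.\<close>

definition vproj :: "or_tensor \<Rightarrow> verma_elem" where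
  "vproj p = pure_tensor h1 h2 c1 (env_class p) 1"

lemma vproj_eq: "vproj p = rels #>\<^bsub>free\<^esub> gen p 1"
  by (simp add: vproj_def pure_tensor_def)

lemma normal_rels: "rels \<lhd> free"
  using subgroup_rels comm_group_free by (simp add: comm_group.normal_iff_subgroup)

lemma verma_group_eq: "verma_group h1 h2 c1 = free Mod rels"
  by (simp add: verma_group_def tensor_product_def verma_rels_def)

lemma group_verma: "group (verma_group h1 h2 c1)"
  unfolding verma_group_eq by (rule normal.factorgroup_is_group[OF normal_rels])

lemma one_verma: "\<one>\<^bsub>verma_group h1 h2 c1\<^esub> = rels"
  by (simp add: verma_group_eq FactGroup_def)

lemma gen_add: "gen (p + q) z - gen p z - gen q z \<in> rels"
  using verma_gens_rels by (auto intro: verma_gensI)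

lemma gen_zero: "gen 0 z \<in> rels"
  using rels_closed(3)[OF gen_add[of 0 0 z]] by simp

text \<open>The scalar z, seen as a constant in U(S_0 + S_+), is moved across the tensor
  sign.\<close>

lemma gen_scalar: "gen p z - gen (p * Poly_Mapping.single 0 z) 1 \<in> rels"
proof -
  have "Poly_Mapping.single 0 z \<in> carrier (tensor_algebra borel_basis)"
    by (simp add: tensor_algebra_def zero_free_word_def)
  moreover have "chi (Poly_Mapping.single 0 z) 1 = z"
    by (simp add: hw_tensor_act_def zero_free_word_def)
  ultimately have "gen (p * Poly_Mapping.single 0 z) 1 - gen p z \<in> verma_gens"
    using verma_gensI(3)[of "Poly_Mapping.single 0 z" p 1] by simp
  then show ?thesis
    using verma_gens_rels rels_closed(3) by fastforce
qed

lemma vproj_add: "vproj p \<otimes>\<^bsub>verma_group h1 h2 c1\<^esub> vproj q = vproj (p + q)"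
proof -
  have "vproj p \<otimes>\<^bsub>verma_group h1 h2 c1\<^esub> vproj q = rels #>\<^bsub>free\<^esub> (gen p 1 + gen q 1)"
    using normal.rcos_sum[OF normal_rels gen_carrier gen_carrier, of p 1 q 1]
    by (simp add: verma_group_eq FactGroup_def vproj_eq)
  also have "\<dots> = vproj (p + q)"
    using rels_closed(3)[OF gen_add[of p q 1]] by (simp add: vproj_eq coset_eq_iff algebra_simps)
  finally show ?thesis .
qed

lemma vproj_zero: "vproj 0 = \<one>\<^bsub>verma_group h1 h2 c1\<^esub>"
proof -
  have "vproj 0 = rels #>\<^bsub>free\<^esub> 0"
    by (simp add: vproj_eq coset_eq_iff gen_zero)
  also have "\<dots> = rels"
    by (auto simp: mem_coset)
  finally show ?thesis
    by (simp add: one_verma)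
qed

text \<open>Induction over the free abelian group: \<open>gen_scalar\<close> treats generators, and
  additivity in the first factor merges a difference of two elements into one.\<close>

lemma carrier_verma: "carrier (verma_group h1 h2 c1) = range vproj"
proof -
  have "\<exists>p. x - gen p 1 \<in> rels" if "Poly_Mapping.keys x \<subseteq> range env_class \<times> UNIV" for x
  proof (rule free_Abelian_group_induct[OF that])
    show "\<exists>p. 0 - gen p 1 \<in> rels"
      using rels_closed(3)[OF gen_zero[of 1]] by (intro exI[of _ 0]) simp
  next
    fix x y assume "\<exists>p. x - gen p 1 \<in> rels" "\<exists>p. y - gen p 1 \<in> rels"
    then obtain p q where "x - gen p 1 \<in> rels" "y - gen q 1 \<in> rels" by blast
    moreover have "gen p 1 - gen (p - q) 1 - gen q 1 \<in> rels"
      using gen_add[of "p - q" q 1] by simp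
    ultimately have "(x - gen p 1) - (y - gen q 1) + (gen p 1 - gen (p - q) 1 - gen q 1) \<in> rels"
      by (rule rels_closed(2)[OF rels_closed(4)])
    then have "x - y - gen (p - q) 1 \<in> rels"
      by (simp add: algebra_simps)
    then show "\<exists>p. x - y - gen p 1 \<in> rels" ..
  next
    fix a :: "or_tensor set \<times> complex" assume "a \<in> range env_class \<times> UNIV"
    then obtain p z where "a = (env_class p, z)" by auto
    then show "\<exists>p. frag_of a - gen p 1 \<in> rels"
      using gen_scalar by blast
  qed
  then have "\<exists>p. rels #>\<^bsub>free\<^esub> x = vproj p" if "x \<in> carrier free" for x
    using that by (simp add: carrier_free vproj_eq coset_eq_iff)
  moreover have "carrier (verma_group h1 h2 c1) = (\<lambda>x. rels #>\<^bsub>free\<^esub> x) ` carrier free"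
    by (auto simp: verma_group_eq FactGroup_def RCOSETS_def)
  ultimately show ?thesis
    using gen_carrier by (fastforce simp: vproj_eq)
qed

lemma inv_vproj: "inv\<^bsub>verma_group h1 h2 c1\<^esub> vproj p = vproj (- p)"
  by (rule group.inv_equality[OF group_verma]) (simp_all add: carrier_verma vproj_add vproj_zero)

section \<open>Left multiplication on the Verma module\<close>

definition free_lmult :: "or_tensor \<Rightarrow> (or_tensor set \<times> complex \<Rightarrow>\<^sub>0 int) \<Rightarrow> or_tensor set \<times> complex \<Rightarrow>\<^sub>0 int" where
  "free_lmult q = frag_extend (\<lambda>(u, z). frag_of (env_class q \<otimes>\<^bsub>U_S\<^esub> u, z))"

lemma free_lmult_gen [simp]: "free_lmult q (gen p z) = gen (q * p) z"
  by (simp add: free_lmult_def)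

text \<open>Left multiplication commutes with the right action, so each kind of relation goes to a
  relation of the same kind. Hence the union over representatives in \<open>verma_env_act\<close> is
  a single coset.\<close>

lemma free_lmult_rels: "x \<in> rels \<Longrightarrow> free_lmult q x \<in> rels"
proof -
  let ?H = "{x \<in> carrier free. free_lmult q x \<in> rels}"
  note lmult = free_lmult_def frag_extend_add frag_extend_minus frag_extend_diff
  have 0: "0 \<in> carrier free"
    by (simp add: carrier_free)
  have "subgroup ?H free"
    by (rule subgroup_freeI) (auto simp: lmult rels_closed(1-3) free_closed 0)
  moreover have "verma_gens \<subseteq> ?H"
  proof
    fix x assume x: "x \<in> verma_gens"
    have diff: "free_lmult q (x - y) = free_lmult q x - free_lmult q y" for x y
      by (simp add: lmult)
    have "free_lmult q x \<in> verma_gens"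
      using x
    proof (cases rule: verma_gensE)
      case (add_left p p' z)
      then show ?thesis
        using verma_gensI(1)[of "q * p" "q * p'" z] by (simp add: diff distrib_left)
    next
      case (add_right p z z')
      then show ?thesis
        using verma_gensI(2)[of "q * p" z z'] by (simp add: diff)
    next
      case (balance p r z)
      then show ?thesis
        using verma_gensI(3)[of r "q * p" z] by (simp add: diff mult.assoc)
    qed
    then show "x \<in> ?H"
      using verma_gens_rels verma_gens_carrier x by blast
  qed
  ultimately show "x \<in> rels \<Longrightarrow> free_lmult q x \<in> rels"
    using rels_minimal by blast
qed

lemma verma_env_act_vproj: "verma_env_act h1 h2 c1 (env_class q) (vproj p) = vproj (q * p)"
proof -
  have "rels #>\<^bsub>free\<^esub> free_lmult q x = vproj (q * p)" if "x \<in> vproj p" for x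
  proof -
    have "free_lmult q (x - gen p 1) \<in> rels"
      using that by (intro free_lmult_rels) (simp add: vproj_eq mem_coset)
    then have "free_lmult q x - gen (q * p) 1 \<in> rels"
      by (simp add: free_lmult_def frag_extend_diff)
    then show ?thesis
      by (simp add: vproj_eq coset_eq_iff)
  qed
  moreover have "gen p 1 \<in> vproj p"
    by (simp add: vproj_eq mem_coset rels_closed(1))
  ultimately show ?thesis
    unfolding verma_env_act_def free_lmult_def[symmetric] by blast
qed

text \<open>The conditions under which p v \<mapsto> f p is well defined on the Verma
  module.\<close>

definition balanced :: "(or_tensor \<Rightarrow> complex) \<Rightarrow> bool" where
  "balanced f \<longleftrightarrow> (\<forall>p q. f (p + q) = f p + f q) \<and> (\<forall>p\<in>env_ideal UNIV. f p = 0)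
    \<and> (\<forall>p. \<forall>q\<in>carrier (tensor_algebra borel_basis). f (p * q) = f p * chi q 1)"

text \<open>The universal property of the tensor product: u \<otimes> z \<mapsto> z f(u) extends
  additively to the free abelian group and kills the relations.\<close>

lemma balanced_vproj:
  assumes "balanced f" "vproj p = vproj q"
  shows "f p = f q"
proof -
  have add: "f (p + q) = f p + f q" for p q
    using assms(1) by (simp add: balanced_def)
  have diff: "f (p - q) = f p - f q" for p q
    using add[of "p - q" q] by simp
  \<comment> \<open>f is constant on classes modulo the ideal, so any representative may be
    chosen.\<close>
  define g where "g u = f (SOME p. p \<in> u)" for u
  have g: "g (env_class p) = f p" for p
  proof -
    have "p \<in> env_class p"
      by (simp add: env_class_iff env_ideal_UNIV_closed)
    then have "(SOME x. x \<in> env_class p) \<in> env_class p"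
      by (rule someI)
    then have "f ((SOME x. x \<in> env_class p) - p) = 0"
      using assms(1) by (simp add: env_class_iff balanced_def)
    then show ?thesis
      by (simp add: g_def diff)
  qed
  define F where "F x = (\<Sum>k\<in>Poly_Mapping.keys x. of_int (Poly_Mapping.lookup x k) * (snd k * g (fst k)))"
    for x :: "or_tensor set \<times> complex \<Rightarrow>\<^sub>0 int"
  have F_superset: "F x = (\<Sum>k\<in>A. of_int (Poly_Mapping.lookup x k) * (snd k * g (fst k)))"
    if "finite A" "Poly_Mapping.keys x \<subseteq> A" for x A
    unfolding F_def using that by (intro sum.mono_neutral_left) (auto simp: in_keys_iff)
  have F_add: "F (x + y) = F x + F y" for x y
    using keys_add[of x y]
    by (simp add: F_superset[of "Poly_Mapping.keys x \<union> Poly_Mapping.keys y"] lookup_add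
        distrib_right sum.distrib)
  have F_gen: "F (gen p z) = z * f p" for p z
    by (simp add: F_def keys_frag_of g)
  have F_diff: "F (x - y) = F x - F y" for x y
    using F_add[of "x - y" y] by simp
  have F_0: "F 0 = 0"
    by (simp add: F_def)
  have F_minus: "F (- x) = - F x" for x
    using F_diff[of 0 x] by (simp add: F_0)
  have "0 \<in> carrier free"
    by (simp add: carrier_free)
  then have "subgroup {x \<in> carrier free. F x = 0} free"
    by (intro subgroup_freeI) (auto simp: F_add F_0 F_minus free_closed)
  moreover have "verma_gens \<subseteq> {x \<in> carrier free. F x = 0}"
  proof -
    have f: "z * f (p * q) = chi q z * f p" if "q \<in> carrier (tensor_algebra borel_basis)" for p q z
      using assms(1) that by (simp add: balanced_def hw_tensor_act_scale[of _ _ _ q z])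
    have "F x = 0" if "x \<in> verma_gens" for x
      using that
      by (cases rule: verma_gensE)
        (simp_all add: F_diff F_gen f add distrib_left distrib_right)
    then show ?thesis
      using verma_gens_carrier by blast
  qed
  ultimately have "F x = 0" if "x \<in> rels" for x
    using rels_minimal that by blast
  then have "F (gen p 1 - gen q 1) = 0"
    using assms(2) by (simp add: vproj_eq coset_eq_iff)
  then show ?thesis
    by (simp add: F_diff F_gen)
qed

text \<open>These are the two words whose coefficients vanish on \<open>rel_span\<close>; the
  character appears because elements of U(S_0 + S_+) multiply v by it exactly.\<close>

lemma balanced_lookup_opact:
  assumes "w = Wd [] \<or> w = Wd [Gg (- 1)]"
  shows "balanced (\<lambda>p. Poly_Mapping.lookup (opact h1 h2 c1 p 1) w)"
  unfolding balanced_def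
proof (intro conjI ballI allI)
  fix p q
  show "Poly_Mapping.lookup (opact h1 h2 c1 (p + q) 1) w
      = Poly_Mapping.lookup (opact h1 h2 c1 p 1) w + Poly_Mapping.lookup (opact h1 h2 c1 q 1) w"
    by (simp add: lin_add[OF lin_opact_left] lookup_add)
next
  fix p :: or_tensor assume "p \<in> env_ideal UNIV"
  then show "Poly_Mapping.lookup (opact h1 h2 c1 p 1) w = 0"
    using lookup_rel_span[OF opact_env_ideal] assms by blast
next
  fix p q assume "q \<in> carrier (tensor_algebra borel_basis)"
  then have "opact h1 h2 c1 q 1 = pscale (chi q 1) 1"
    using pscale_simps(4)[of "chi q 1" "0 :: or_basis free_word" 1] by (simp add: opact_borel)
  then show "Poly_Mapping.lookup (opact h1 h2 c1 (p * q) 1) w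
      = Poly_Mapping.lookup (opact h1 h2 c1 p 1) w * chi q 1"
    by (simp add: opact_mult lin_scale[OF lin_opact])
qed

text \<open>The coefficient of the word G_{-1/2} is 1 on G_{-1/2} v and 0 on 0. The coefficient of
  the empty word is 1 on v and 0 on every q G_{-1/2} v.\<close>

lemma vproj_singular:
  shows "vproj (letter (Gg (- 1))) \<noteq> \<one>\<^bsub>verma_group h1 h2 c1\<^esub>"
    and "vproj 1 \<noteq> vproj (q * letter (Gg (- 1)))"
proof -
  have "Gg (- 1) \<notin> borel_basis"
    by (auto simp: borel_basis_def)
  then have G: "opact h1 h2 c1 (letter (Gg (- 1))) 1 = letter (Gg (- 1))"
    by (simp add: opact_letter gact_neg)
  show "vproj (letter (Gg (- 1))) \<noteq> \<one>\<^bsub>verma_group h1 h2 c1\<^esub>"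
  proof
    assume "vproj (letter (Gg (- 1))) = \<one>\<^bsub>verma_group h1 h2 c1\<^esub>"
    then have "vproj (letter (Gg (- 1))) = vproj 0"
      by (simp add: vproj_zero)
    from balanced_vproj[OF balanced_lookup_opact[of "Wd [Gg (- 1)]"] this]
    show False
      by (simp add: G lin_zero[OF lin_opact_left])
  qed
  show "vproj 1 \<noteq> vproj (q * letter (Gg (- 1)))"
  proof
    assume "vproj 1 = vproj (q * letter (Gg (- 1)))"
    from balanced_vproj[OF balanced_lookup_opact[of "Wd []"] this]
    show False
      by (simp add: opact_one opact_mult G lookup_opact_singular lookup_one zero_free_word_def)
  qed
qed

section \<open>Parity\<close>

lemma vproj_parity:
  assumes "\<And>w. w \<in> Poly_Mapping.keys q \<Longrightarrow> odd (length (filter odd_gen (letters w))) = (i \<noteq> s)"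
  shows "vproj q \<in> part (verma s h1 h2 c1) i"
proof -
  have "env_class q \<in> env_part (i \<noteq> s)"
    unfolding env_part_def using assms by blast
  then show ?thesis
    by (auto simp: verma_def vproj_def intro: generate.incl)
qed

end

lemma odd_letters_mult_G:
  assumes "w \<in> Poly_Mapping.keys (q * letter (Gg k))"
    and "\<And>w. w \<in> Poly_Mapping.keys q \<Longrightarrow> odd (length (filter odd_gen (letters w))) = i"
  shows "odd (length (filter odd_gen (letters w))) = (\<not> i)"
  using assms(1) keys_mult[of q "letter (Gg k)"] assms(2) by (fastforce simp: plus_free_word_def)

lemma parity_decomposition:
  fixes q :: or_tensor
  obtains r :: "bool \<Rightarrow> or_tensor" where "q = r False + r True"
    "\<And>i w. w \<in> Poly_Mapping.keys (r i) \<Longrightarrow> odd (length (filter odd_gen (letters w))) = i"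
proof
  define r where "r i = lext (\<lambda>w. if odd (length (filter odd_gen (letters w))) = i
      then Poly_Mapping.single w 1 else 0) q" for i
  have "q = lext (\<lambda>w. Poly_Mapping.single w 1) q"
    by (simp add: lext_single_one)
  also have "\<dots> = r False + r True"
    unfolding r_def by (subst lext_fun_add[symmetric]) (rule lext_cong, simp)
  finally show "q = r False + r True" .
  fix i w assume "w \<in> Poly_Mapping.keys (r i)"
  moreover have "r i \<in> {p. Poly_Mapping.keys p \<subseteq> {w. odd (length (filter odd_gen (letters w))) = i}}"
    unfolding r_def by (rule lext_in_subspace[OF lin_subspace_keys]) auto
  ultimately show "odd (length (filter odd_gen (letters w))) = i"
    by blast
qed

theorem mainTheorem4:
  fixes h1 h2 c1 :: complex and p :: bool
  shows "reducible (verma p h1 h2 c1)"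
proof -
  let ?M = "verma p h1 h2 c1" and ?V = "verma_group h1 h2 c1" and ?G = "letter (Gg (- 1))"
  let ?v = "vproj h1 h2 c1"
  let ?N = "range (\<lambda>q. ?v (q * ?G))"
  have M: "carrier ?M = carrier ?V" "mult ?M = mult ?V" "one ?M = one ?V"
    by (simp_all add: verma_def)
  have inv: "inv\<^bsub>?M\<^esub> x = inv\<^bsub>?V\<^esub> x" for x
    by (simp add: m_inv_def M)
  have mem: "?v (q * ?G) \<in> ?N" for q
    by blast
  have "subgroup ?N ?M"
  proof (rule subgroup.intro)
    fix x y assume "x \<in> ?N" "y \<in> ?N"
    then show "x \<otimes>\<^bsub>?M\<^esub> y \<in> ?N"
      using mem by (auto simp: M vproj_add simp flip: distrib_right)
  next
    fix x assume "x \<in> ?N"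
    then show "inv\<^bsub>?M\<^esub> x \<in> ?N"
      using mem by (auto simp: inv inv_vproj minus_mult_left simp del: mult_minus_left)
  next
    show "\<one>\<^bsub>?M\<^esub> \<in> ?N"
      using mem[of 0] by (simp add: M vproj_zero)
  qed (auto simp: M carrier_verma)
  moreover have "scal ?M c x \<in> ?N" "act ?M a x \<in> ?N" if "x \<in> ?N" for c a x
    using that mem by (auto simp: verma_def verma_env_act_vproj simp flip: mult.assoc)
  moreover have "\<exists>n0\<in>?N \<inter> part ?M False. \<exists>n1\<in>?N \<inter> part ?M True. x = n0 \<otimes>\<^bsub>?M\<^esub> n1"
    if "x \<in> ?N" for x
  proof -
    from that obtain q where x: "x = ?v (q * ?G)"
      by blast
    obtain r where q: "q = r False + r True"
      and r: "\<And>i w. w \<in> Poly_Mapping.keys (r i) \<Longrightarrow> odd (length (filter odd_gen (letters w))) = i"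
      using parity_decomposition[of q] by metis
    \<comment> \<open>The factor G_{-1/2} flips the parity i and v contributes p; the sum of
      \<open>\<not> i\<close> and p in Z/2 is \<open>p = i\<close>.\<close>
    have r_part: "?v (r i * ?G) \<in> part ?M (p = i)" for i
      by (rule vproj_parity) (use odd_letters_mult_G[OF _ r] in auto)
    \<comment> \<open>By \<open>r_part\<close> the even component comes from
      \<open>r (\<not> p)\<close> and the odd one from \<open>r p\<close>.\<close>
    have sum: "x = ?v (r (\<not> p) * ?G + r p * ?G)"
      by (cases p) (simp_all add: x q distrib_right add.commute)
    show ?thesis
    proof (intro bexI)
      show "x = ?v (r (\<not> p) * ?G) \<otimes>\<^bsub>?M\<^esub> ?v (r p * ?G)"
        using sum by (simp only: M vproj_add)
    qed (use r_part[of p] r_part[of "\<not> p"] in auto)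
  qed
  ultimately have "graded_submodule ?N ?M"
    unfolding graded_submodule_def by (intro conjI allI ballI)
  moreover have "?N \<noteq> {\<one>\<^bsub>?M\<^esub>}"
  proof
    assume "?N = {\<one>\<^bsub>?M\<^esub>}"
    then have "?v ?G = \<one>\<^bsub>?V\<^esub>"
      using mem[of 1] by (simp add: M)
    then show False
      using vproj_singular(1) by blast
  qed
  moreover have "?v 1 \<in> carrier ?M" "?v 1 \<notin> ?N"
    using vproj_singular(2) by (auto simp: M carrier_verma)
  then have "?N \<noteq> carrier ?M"
    by blast
  ultimately show ?thesis
    unfolding reducible_def by (intro exI[of _ ?N] conjI)
qed

end
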